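(* Let $k>r>2$ and $t\ge 1$ be integers. Then for all sufficiently large $n$, $$ex_r(n,\mathbb{B}_t^rK_k)=ex_r(n,\mathbb{H}_t^rK_k)=|\mathcal{Q}^r_t(n,k-1)|.$$
   Context: A hypergraph consists of a finite vertex set and a set of distinct subsets of it (hyperedges); it is $r$-uniform if all hyperedges have size $r$. For an integer $t\ge1$ and a graph $F$, a hypergraph $\mathcal{F}$ is a $t$-heavy copy of $F$ if there exist an injection $i:V(F)\to V(\mathcal{F})$ and a map $h$ assigning to each edge $e$ of $F$ a set $h(e)$ of $t$ distinct hyperedges of $\mathcal{F}$ such that for every edge $e=xy$ of $F$, $\{i(x),i(y)\}\subseteq A$ for all $A\in h(e)$. It is a $t$-wise Berge copy of $F$ if moreover $|E(\mathcal{F})|=t|E(F)|$ and such $i,h$ exist with $h(e)\cap h(e')=\emptyset$ for distinct edges $e,e'$. $\mathbb{H}_t^rF$, $\mathbb{B}_t^rF$ denote the families of $r$-uniform $t$-heavy, resp. $t$-wise Berge, copies of $F$. $ex_r(n,\mathbb{F})$ is the maximum number of hyperedges in an $r$-uniform hypergraph on $n$ vertices containing no member of $\mathbb{F}$ as a subhypergraph. $\mathcal{T}^r(n,k-1)$ is the complete balanced $(k-1)$-partite $r$-uniform hypergraph on $n$ vertices: the vertex set is partitioned into $k-1$ parts whose sizes differ by at most one, and the hyperedges are all $r$-sets meeting each part in at most one vertex. $\mathcal{Q}^r_t(n,k-1)$ is obtained from $\mathcal{T}^r(n,k-1)$ as follows: for every pair $u,v$ of vertices lying in the same part, choose $t-1$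 different $(r-2)$-sets each of which meets $r-2$ other parts (one vertex in each), and add the $t-1$ sets $\{u,v\}\cup S$ as hyperedges (this is possible for $n$ large). *)

theory Defs
  imports Complex_Main "HOL-Library.Ramsey" "HOL-Library.Disjoint_Sets"
begin

type_synonym 'a hypergraph = "'a set \<times> 'a set set"

abbreviation verts :: "'a hypergraph \<Rightarrow> 'a set" where "verts \<equiv> fst"

abbreviation hedges :: "'a hypergraph \<Rightarrow> 'a set set" where "hedges \<equiv> snd"

definition hypergraph :: "'a hypergraph \<Rightarrow> bool" where
  "hypergraph H \<longleftrightarrow> finite (verts H) \<and> hedges H \<subseteq> Pow (verts H)"

definition uniform_hypergraph :: "nat \<Rightarrow> 'a hypergraph \<Rightarrow> bool" where
  "uniform_hypergraph r H \<longleftrightarrow> hypergraph H \<and> (\<forall>A\<in>hedges H. card A = r)"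

text \<open>Graphs are 2-uniform hypergraphs.\<close>

definition complete_graph :: "nat \<Rightarrow> nat hypergraph" where
  "complete_graph k = ({..<k}, [{..<k}]\<^bsup>2\<^esup>)"

text \<open>
  The core map \<open>i\<close> need not be onto, so heavy and Berge copies may have further vertices.
  For an edge \<open>e = {x, y}\<close> of \<open>F\<close>, the image \<open>i ` e\<close> is \<open>{i x, i y}\<close>.
\<close>

definition heavy_witness ::
  "nat \<Rightarrow> 'a hypergraph \<Rightarrow> 'b hypergraph \<Rightarrow> ('a \<Rightarrow> 'b) \<Rightarrow> ('a set \<Rightarrow> 'b set set) \<Rightarrow> bool" where
  "heavy_witness t F H i h \<longleftrightarrow>
     inj_on i (verts F) \<and> i ` verts F \<subseteq> verts H \<and>
     (\<forall>e\<in>hedges F. h e \<in> [hedges H]\<^bsup>t\<^esup> \<and> (\<forall>A\<in>h e. i ` e \<subseteq> A))"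

definition heavy_copy :: "nat \<Rightarrow> 'a hypergraph \<Rightarrow> 'b hypergraph \<Rightarrow> bool" where
  "heavy_copy t F H \<longleftrightarrow> (\<exists>i h. heavy_witness t F H i h)"

definition berge_copy :: "nat \<Rightarrow> 'a hypergraph \<Rightarrow> 'b hypergraph \<Rightarrow> bool" where
  "berge_copy t F H \<longleftrightarrow>
     card (hedges H) = t * card (hedges F) \<and>
     (\<exists>i h. heavy_witness t F H i h \<and> disjoint_family_on h (hedges F))"

text \<open>Every finite hypergraph is isomorphic to one whose vertices are natural numbers.\<close>

definition heavy_family :: "nat \<Rightarrow> nat \<Rightarrow> 'a hypergraph \<Rightarrow> nat hypergraph set" where
  "heavy_family t r F = {H. uniform_hypergraph r H \<and> heavy_copy t F H}"

definition berge_family :: "nat \<Rightarrow> nat \<Rightarrow> 'a hypergraph \<Rightarrow> nat hypergraph set" where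
  "berge_family t r F = {H. uniform_hypergraph r H \<and> berge_copy t F H}"

text \<open>Containment of \<open>G\<close> as a subhypergraph is understood up to isomorphism.\<close>

definition contains_copy :: "'b hypergraph \<Rightarrow> 'a hypergraph \<Rightarrow> bool" where
  "contains_copy H G \<longleftrightarrow>
     (\<exists>f. inj_on f (verts G) \<and> f ` verts G \<subseteq> verts H \<and> (\<forall>A\<in>hedges G. f ` A \<in> hedges H))"

definition ex_number :: "nat \<Rightarrow> nat \<Rightarrow> 'a hypergraph set \<Rightarrow> nat" where
  "ex_number r n \<F> =
     Max {card (hedges H) | H :: nat hypergraph.
            uniform_hypergraph r H \<and> card (verts H) = n \<and> (\<forall>G\<in>\<F>. \<not> contains_copy H G)}"

definition balanced_parts :: "'a set \<Rightarrow> nat \<Rightarrow> (nat \<Rightarrow> 'a set) \<Rightarrow> bool" where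
  "balanced_parts V p P \<longleftrightarrow>
     finite V \<and> (\<Union>j<p. P j) = V \<and> disjoint_family_on P {..<p} \<and>
     (\<forall>i<p. \<forall>j<p. card (P i) \<le> card (P j) + 1)"

text \<open>The \<open>s\<close>-sets inside the parts with index in \<open>I\<close> that have at most one vertex in each part.\<close>

definition transversals :: "(nat \<Rightarrow> 'a set) \<Rightarrow> nat set \<Rightarrow> nat \<Rightarrow> 'a set set" where
  "transversals P I s = {A \<in> [\<Union>j\<in>I. P j]\<^bsup>s\<^esup>. \<forall>j\<in>I. card (A \<inter> P j) \<le> 1}"

definition turan_hypergraph :: "nat \<Rightarrow> nat \<Rightarrow> (nat \<Rightarrow> 'a set) \<Rightarrow> 'a hypergraph" where
  "turan_hypergraph r p P = (\<Union>j<p. P j, transversals P {..<p} r)"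

text \<open>
  The construction depends on choices, hence a set of hypergraphs; \<open>S e\<close> is the collection of
  \<open>t - 1\<close> sets chosen for the pair \<open>e\<close>.
\<close>

definition Q_hypergraphs :: "nat \<Rightarrow> nat \<Rightarrow> nat \<Rightarrow> nat \<Rightarrow> nat hypergraph set" where
  "Q_hypergraphs t r n p =
     {(V, hedges (turan_hypergraph r p P) \<union> (\<Union>i<p. \<Union>e\<in>[P i]\<^bsup>2\<^esup>. (\<lambda>X. e \<union> X) ` S e)) | V P S.
        card V = n \<and> balanced_parts V p P \<and>
        (\<forall>i<p. \<forall>e\<in>[P i]\<^bsup>2\<^esup>. S e \<in> [transversals P ({..<p} - {i}) (r - 2)]\<^bsup>(t - 1)\<^esup>)}"

end

theory Submission
  imports Defs
begin

text \<open>
  Let \<open>p = k - 1\<close>, \<open>c = t - 1\<close>, and call a pair of vertices heavy if it lies in at least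
  \<open>D = t * (k choose 2)\<close> hyperedges of a given \<open>t\<close>-wise Berge-\<open>K\<^sub>k\<close>-free \<open>r\<close>-graph. Disjoint sets
  of hyperedges can be chosen greedily, so the graph \<open>E\<close> of heavy pairs is \<open>K\<^sub>k\<close>-free; moreover a light
  pair lies in at most \<open>c\<close> hyperedges unless it is addable, that is, unless adding it alone
  to \<open>E\<close> creates no \<open>K\<^sub>k\<close>. Hence the number of hyperedges is at most the score of \<open>E\<close>: the number of
  \<open>r\<close>-cliques plus \<open>c\<close> times the number of nonedges plus \<open>D\<close> times the number of addable pairs.

  It remains to show that for large \<open>n\<close> the score of a \<open>K\<^sub>k\<close>-free graph is maximal for the balanced
  complete \<open>p\<close>-partite graph. By progressive induction (deleting a vertex that contributes too
  little) we may assume that all degrees are at least \<open>n - n / p - O(1)\<close>. Then \<open>E\<close> together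
  with all addable pairs is \<open>p\<close>-partite, and each addable pair would create more \<open>r\<close>-cliques than it
  contributes to the score, so we may assume that no pair is addable. The remaining functional,
  \<open>r\<close>-cliques minus \<open>c\<close> times edges, is treated by Zykov symmetrization; perturbing \<open>c\<close> to a
  non-integer makes every edge of an extremal graph contribute a nonzero amount.
\<close>

section \<open>Weighted clique counts and Zykov symmetrization\<close>

definition sgraph :: "('a \<Rightarrow> 'a \<Rightarrow> bool) \<Rightarrow> bool" where
  "sgraph E \<longleftrightarrow> symp E \<and> irreflp E"

definition cliques :: "('a \<Rightarrow> 'a \<Rightarrow> bool) \<Rightarrow> 'a set \<Rightarrow> 'a set set" where
  "cliques E V = {S. S \<subseteq> V \<and> finite S \<and> (\<forall>x\<in>S. \<forall>y\<in>S. x \<noteq> y \<longrightarrow> E x y)}"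

definition kcliques :: "('a \<Rightarrow> 'a \<Rightarrow> bool) \<Rightarrow> nat \<Rightarrow> 'a set \<Rightarrow> 'a set set" where
  "kcliques E m V = {S \<in> cliques E V. card S = m}"

definition nbrs :: "('a \<Rightarrow> 'a \<Rightarrow> bool) \<Rightarrow> 'a set \<Rightarrow> 'a \<Rightarrow> 'a set" where
  "nbrs E V v = {x \<in> V. E v x}"

text \<open>Weights depending only on the size of a clique cover all functionals needed later:
  clique counts, and clique counts minus a multiple of the edge count. Shifting \<open>a\<close> by
  one describes the link of a vertex.\<close>

definition wt :: "(nat \<Rightarrow> real) \<Rightarrow> ('a \<Rightarrow> 'a \<Rightarrow> bool) \<Rightarrow> 'a set \<Rightarrow> real" where
  "wt a E V = (\<Sum>S\<in>cliques E V. a (card S))"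

lemma sgraph_sym: "sgraph E \<Longrightarrow> E x y \<Longrightarrow> E y x"
  by (auto simp: sgraph_def dest: sympD)

lemma sgraph_irrefl: "sgraph E \<Longrightarrow> \<not> E x x"
  by (auto simp: sgraph_def dest: irreflpD)

lemma sgraphI: "(\<And>x y. E x y \<Longrightarrow> E y x) \<Longrightarrow> (\<And>x. \<not> E x x) \<Longrightarrow> sgraph E"
  by (auto simp: sgraph_def intro: sympI irreflpI)

lemma finite_cliques: "finite V \<Longrightarrow> finite (cliques E V)"
  by (rule finite_subset[of _ "Pow V"]) (auto simp: cliques_def)

lemma finite_kcliques: "finite V \<Longrightarrow> finite (kcliques E m V)"
  by (simp add: kcliques_def finite_cliques)

lemma finite_nbrs: "finite V \<Longrightarrow> finite (nbrs E V v)"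
  by (simp add: nbrs_def)

lemma cliques_cong:
  "(\<And>x y. x \<in> V \<Longrightarrow> y \<in> V \<Longrightarrow> E x y \<longleftrightarrow> E' x y) \<Longrightarrow> cliques E V = cliques E' V"
  unfolding cliques_def by (auto 0 4 simp: subset_iff)

lemma wt_cong:
  "V = V' \<Longrightarrow> (\<And>x y. x \<in> V' \<Longrightarrow> y \<in> V' \<Longrightarrow> E x y \<longleftrightarrow> E' x y) \<Longrightarrow> wt a E V = wt a E' V'"
  unfolding wt_def using cliques_cong[of V' E E'] by auto

lemma wt_nonneg: "(\<And>j. a j \<ge> 0) \<Longrightarrow> wt a E V \<ge> 0"
  by (simp add: wt_def sum_nonneg)

lemma cliques_remove:
  assumes "sgraph E" "v \<in> V"
  shows "cliques E V = cliques E (V - {v}) \<union> insert v ` cliques E (nbrs E V v)"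
proof (intro set_eqI iffI)
  fix S assume S: "S \<in> cliques E V"
  show "S \<in> cliques E (V - {v}) \<union> insert v ` cliques E (nbrs E V v)"
  proof (cases "v \<in> S")
    case True
    then have "S - {v} \<in> cliques E (nbrs E V v)" "S = insert v (S - {v})"
      using S by (auto simp: cliques_def nbrs_def)
    then show ?thesis by blast
  qed (use S in \<open>auto simp: cliques_def\<close>)
next
  fix S assume "S \<in> cliques E (V - {v}) \<union> insert v ` cliques E (nbrs E V v)"
  then show "S \<in> cliques E V"
    using assms sgraph_sym[OF assms(1)] by (auto simp: cliques_def nbrs_def subset_iff)
qed

text \<open>Cliques through \<open>v\<close> are the cliques of its neighbourhood with
  \<open>v\<close> added, which shifts the weight index by one.\<close>

lemma wt_remove:
  assumes "sgraph E" "v \<in> V" "finite V"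
  shows "wt a E V = wt a E (V - {v}) + wt (\<lambda>j. a (Suc j)) E (nbrs E V v)"
proof -
  have nv: "v \<notin> S" if "S \<in> cliques E (nbrs E V v)" for S
    using that sgraph_irrefl[OF assms(1)] by (auto simp: cliques_def nbrs_def)
  have inj: "inj_on (insert v) (cliques E (nbrs E V v))"
    by (rule inj_onI) (metis insert_ident nv)
  have "wt a E V = wt a E (V - {v}) + (\<Sum>S\<in>insert v ` cliques E (nbrs E V v). a (card S))"
    unfolding wt_def cliques_remove[OF assms(1,2)]
    by (rule sum.union_disjoint)
      (use assms in \<open>auto simp: finite_cliques finite_nbrs, auto simp: cliques_def\<close>)
  also have "(\<Sum>S\<in>insert v ` cliques E (nbrs E V v). a (card S)) = wt (\<lambda>j. a (Suc j)) E (nbrs E V v)"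
    unfolding wt_def
    by (subst sum.reindex[OF inj], rule sum.cong)
      (use nv in \<open>auto simp: cliques_def card_insert_if\<close>)
  finally show ?thesis .
qed

lemma card_kcliques_wt:
  assumes "finite V"
  shows "real (card (kcliques E m V)) = wt (\<lambda>j. of_bool (j = m)) E V"
proof -
  have "wt (\<lambda>j. of_bool (j = m)) E V = (\<Sum>S\<in>kcliques E m V. 1)"
    unfolding wt_def kcliques_def
    by (rule sum.mono_neutral_cong_right) (use finite_cliques[OF assms] in auto)
  then show ?thesis by simp
qed

lemma card_kcliques_remove:
  assumes "sgraph E" "v \<in> V" "finite V"
  shows "card (kcliques E (Suc m) V) =
    card (kcliques E (Suc m) (V - {v})) + card (kcliques E m (nbrs E V v))"
proof -
  have "real (card (kcliques E (Suc m) V)) =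
    real (card (kcliques E (Suc m) (V - {v})) + card (kcliques E m (nbrs E V v)))"
    using wt_remove[OF assms, of "\<lambda>j. of_bool (j = Suc m)"] assms
    by (simp add: card_kcliques_wt finite_nbrs)
  then show ?thesis by linarith
qed

lemma kcliques_0: "kcliques E 0 V = {{}}"
  by (auto simp: kcliques_def cliques_def)

lemma kcliques_mono: "V \<subseteq> W \<Longrightarrow> kcliques E m V \<subseteq> kcliques E m W"
  by (auto simp: kcliques_def cliques_def)

text \<open>The new cliques are those containing both \<open>u\<close> and \<open>v\<close>; each
  comes from a clique of the common neighbourhood \<open>nbrs E (nbrs E V u) v\<close>, hence the
  double shift.\<close>

lemma wt_add_edge:
  assumes E: "sgraph E" and V: "finite V" "u \<in> V" "v \<in> V" "u \<noteq> v" and n: "\<not> E u v"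
  defines "E' \<equiv> \<lambda>x y. E x y \<or> {x, y} = {u, v}"
  shows "wt a E' V = wt a E V + wt (\<lambda>j. a (Suc (Suc j))) E (nbrs E (nbrs E V u) v)"
proof -
  have E': "sgraph E'"
    using V(4) sgraph_irrefl[OF E] sgraph_sym[OF E] by (intro sgraphI) (auto simp: E'_def doubleton_eq_iff)
  let ?N = "nbrs E V u"
  have v: "v \<notin> ?N" "u \<notin> ?N" using n sgraph_irrefl[OF E] by (auto simp: nbrs_def)
  have "wt a E' V = wt a E' (V - {u}) + wt (\<lambda>j. a (Suc j)) E' (nbrs E' V u)"
    by (rule wt_remove[OF E' V(2,1)])
  also have "wt a E' (V - {u}) = wt a E (V - {u})"
    by (rule wt_cong) (auto simp: E'_def doubleton_eq_iff)
  also have N': "nbrs E' V u = insert v ?N"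
    using V by (auto simp: nbrs_def E'_def doubleton_eq_iff)
  also have "wt (\<lambda>j. a (Suc j)) E' (insert v ?N) =
      wt (\<lambda>j. a (Suc j)) E' (insert v ?N - {v}) + wt (\<lambda>j. a (Suc (Suc j))) E' (nbrs E' (insert v ?N) v)"
    by (rule wt_remove[OF E']) (use V finite_nbrs in auto)
  also have "insert v ?N - {v} = ?N" using v by auto
  also have "wt (\<lambda>j. a (Suc j)) E' ?N = wt (\<lambda>j. a (Suc j)) E ?N"
    by (rule wt_cong) (use v in \<open>auto simp: E'_def doubleton_eq_iff\<close>)
  also have "wt (\<lambda>j. a (Suc (Suc j))) E' (nbrs E' (insert v ?N) v) =
      wt (\<lambda>j. a (Suc (Suc j))) E (nbrs E ?N v)"
    by (rule wt_cong)
      (use v V sgraph_irrefl[OF E] in \<open>auto simp: E'_def nbrs_def doubleton_eq_iff\<close>)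
  finally show ?thesis using wt_remove[OF E V(2,1), of a] by simp
qed

text \<open>Zykov's operation: for irreflexive \<open>E\<close>, the vertex \<open>v\<close> becomes
  a nonadjacent twin of \<open>u\<close>.\<close>

definition clone :: "'a \<Rightarrow> 'a \<Rightarrow> ('a \<Rightarrow> 'a \<Rightarrow> bool) \<Rightarrow> 'a \<Rightarrow> 'a \<Rightarrow> bool" where
  "clone v u E = (\<lambda>x y. E (if x = v then u else x) (if y = v then u else y))"

lemma sgraph_clone: "sgraph E \<Longrightarrow> sgraph (clone v u E)"
  by (rule sgraphI) (auto simp: clone_def sgraph_irrefl dest: sgraph_sym)

text \<open>Redirecting \<open>v\<close> to \<open>u\<close> is injective on a clique, since twins
  are nonadjacent, and yields a clique of \<open>E\<close> of the same size.\<close>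

lemma clone_kfree:
  assumes E: "sgraph E" and u: "u \<in> V" and K: "kcliques E m V = {}"
  shows "kcliques (clone v u E) m V = {}"
proof (rule equals0I)
  fix S assume S: "S \<in> kcliques (clone v u E) m V"
  define \<sigma> where "\<sigma> = (\<lambda>x. if x = v then u else x)"
  have *: "E (\<sigma> x) (\<sigma> y)" if "x \<in> S" "y \<in> S" "x \<noteq> y" for x y
    using S that unfolding kcliques_def cliques_def clone_def \<sigma>_def by blast
  have inj: "inj_on \<sigma> S"
    by (rule inj_onI) (metis * sgraph_irrefl[OF E])
  have "\<sigma> ` S \<subseteq> V" using S u by (auto simp: kcliques_def cliques_def \<sigma>_def)
  moreover have "E x y" if "x \<in> \<sigma> ` S" "y \<in> \<sigma> ` S" "x \<noteq> y" for x y using * that by blast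
  ultimately have "\<sigma> ` S \<in> kcliques E m V"
    using S card_image[OF inj] unfolding kcliques_def cliques_def by auto
  with K show False by simp
qed

lemma wt_clone:
  assumes E: "sgraph E" and V: "finite V" "v \<in> V" "u \<noteq> v"
  shows "wt a (clone v u E) V = wt a E (V - {v}) + wt (\<lambda>j. a (Suc j)) E (nbrs E (V - {v}) u)"
proof -
  have "wt a (clone v u E) (V - {v}) = wt a E (V - {v})"
    by (rule wt_cong) (auto simp: clone_def)
  moreover have "wt (\<lambda>j. a (Suc j)) (clone v u E) (nbrs (clone v u E) V v) =
      wt (\<lambda>j. a (Suc j)) E (nbrs E (V - {v}) u)"
    by (rule wt_cong) (use sgraph_irrefl[OF E] in \<open>auto simp: clone_def nbrs_def split: if_splits\<close>)
  ultimately show ?thesis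
    by (simp add: wt_remove[OF sgraph_clone[OF E] V(2,1)])
qed

text \<open>A clique uses at most one vertex of the independent set \<open>B\<close>, and each
  clique of \<open>X\<close> extends by every vertex of \<open>B\<close>.\<close>

lemma wt_join_independent:
  assumes E: "sgraph E" and B: "finite B" and X: "finite X" and d: "B \<inter> X = {}"
    and n: "\<And>b. b \<in> B \<Longrightarrow> nbrs E (X \<union> B) b = X"
  shows "wt a E (X \<union> B) = wt a E X + card B * wt (\<lambda>j. a (Suc j)) E X"
  using B d n
proof (induction B rule: finite_induct)
  case (insert b B)
  have "nbrs E (X \<union> B) c = X" if "c \<in> B" for c
    using insert.prems(2)[of c] that insert.hyps insert.prems(1) by (auto simp: nbrs_def)
  then have "wt a E (X \<union> B) = wt a E X + card B * wt (\<lambda>j. a (Suc j)) E X"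
    using insert by auto
  moreover have "(X \<union> insert b B) - {b} = X \<union> B" using insert by auto
  ultimately show ?case
    using wt_remove[OF E, of b "X \<union> insert b B" a] insert X by (simp add: algebra_simps)
qed auto

text \<open>Classes are fibres of a colouring. They may be empty, so fewer vertices than colours are
  allowed.\<close>

definition balanced :: "('a \<Rightarrow> 'b) \<Rightarrow> 'a set \<Rightarrow> 'b set \<Rightarrow> bool" where
  "balanced col V I \<longleftrightarrow> finite V \<and> finite I \<and> col ` V \<subseteq> I \<and>
     (\<forall>i\<in>I. \<forall>j\<in>I. card {x \<in> V. col x = i} \<le> card {x \<in> V. col x = j} + 1)"

section \<open>Structure of weight-maximal graphs\<close>

context
  fixes a :: "nat \<Rightarrow> real" and E :: "'a \<Rightarrow> 'a \<Rightarrow> bool" and V :: "'a set" and p :: nat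
  assumes E: "sgraph E" and V: "finite V" and free: "kcliques E (Suc p) V = {}"
    and max: "\<And>E'. sgraph E' \<Longrightarrow> kcliques E' (Suc p) V = {} \<Longrightarrow> wt a E' V \<le> wt a E V"
    and nz: "\<And>E (X :: 'a set). finite X \<Longrightarrow> wt (\<lambda>j. a (Suc (Suc j))) E X \<noteq> 0"
begin

text \<open>Deleting the edge cannot raise the maximal weight, so its contribution is nonnegative;
  \<open>nz\<close> excludes zero.\<close>

lemma zykov_edge:
  assumes uv: "u \<in> V" "v \<in> V" "E u v"
  shows "wt (\<lambda>j. a (Suc (Suc j))) E (nbrs E (nbrs E V u) v) > 0"
proof -
  define F where "F = (\<lambda>x y. E x y \<and> {x, y} \<noteq> {u, v})"
  have ne: "u \<noteq> v" using uv sgraph_irrefl[OF E] by auto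
  have F: "sgraph F"
    using sgraph_irrefl[OF E] sgraph_sym[OF E] by (intro sgraphI) (auto simp: F_def insert_commute)
  have FE: "(\<lambda>x y. F x y \<or> {x, y} = {u, v}) = E"
    using uv sgraph_sym[OF E] by (auto simp: F_def fun_eq_iff doubleton_eq_iff)
  have "kcliques F (Suc p) V \<subseteq> kcliques E (Suc p) V"
    by (auto simp: kcliques_def cliques_def F_def)
  then have "wt a F V \<le> wt a E V" using max[OF F] free by auto
  moreover have "\<not> F u v" by (simp add: F_def)
  ultimately have "wt (\<lambda>j. a (Suc (Suc j))) F (nbrs F (nbrs F V u) v) \<ge> 0"
    using wt_add_edge[OF F V uv(1,2) ne, of a] unfolding FE by simp
  also have "wt (\<lambda>j. a (Suc (Suc j))) F (nbrs F (nbrs F V u) v) =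
      wt (\<lambda>j. a (Suc (Suc j))) E (nbrs E (nbrs E V u) v)"
    by (rule wt_cong) (use sgraph_irrefl[OF E] in \<open>auto simp: F_def nbrs_def doubleton_eq_iff\<close>)
  finally show ?thesis using nz[of "nbrs E (nbrs E V u) v" E] V finite_nbrs
    by (metis order_le_less)
qed

text \<open>Making \<open>v\<close> a twin of \<open>u\<close> replaces the link weight of
  \<open>v\<close> by that of \<open>u\<close>, and maximality forbids a gain.\<close>

lemma zykov_nonadjacent_le:
  assumes uv: "u \<in> V" "v \<in> V" "\<not> E u v"
  shows "wt (\<lambda>j. a (Suc j)) E (nbrs E V u) \<le> wt (\<lambda>j. a (Suc j)) E (nbrs E V v)"
proof (cases "u = v")
  case False
  have "wt a (clone v u E) V \<le> wt a E V"
    by (rule max[OF sgraph_clone[OF E] clone_kfree[OF E uv(1) free]])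
  moreover have "nbrs E (V - {v}) u = nbrs E V u" using uv by (auto simp: nbrs_def)
  ultimately show ?thesis
    using wt_clone[OF E V uv(2) False, of a] wt_remove[OF E uv(2) V, of a] by simp
qed simp

text \<open>The same exchange, but now \<open>v\<close> is a neighbour of \<open>u\<close>, so the
  twin inherits only the link cliques of \<open>u\<close> that avoid \<open>v\<close>; the last term
  accounts for the others.\<close>

lemma zykov_adjacent_le:
  assumes uv: "u \<in> V" "v \<in> V" "E u v"
  shows "wt (\<lambda>j. a (Suc j)) E (nbrs E V u) \<le> wt (\<lambda>j. a (Suc j)) E (nbrs E V v)
    + wt (\<lambda>j. a (Suc (Suc j))) E (nbrs E (nbrs E V u) v)"
proof -
  have ne: "u \<noteq> v" using uv sgraph_irrefl[OF E] by auto
  have "wt a (clone v u E) V \<le> wt a E V"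
    by (rule max[OF sgraph_clone[OF E] clone_kfree[OF E uv(1) free]])
  moreover have "nbrs E (V - {v}) u = nbrs E V u - {v}" by (auto simp: nbrs_def)
  moreover have "v \<in> nbrs E V u" using uv by (auto simp: nbrs_def)
  ultimately show ?thesis
    using wt_clone[OF E V uv(2) ne, of a] wt_remove[OF E uv(2) V, of a]
      wt_remove[OF E, of v "nbrs E V u" "\<lambda>j. a (Suc j)"] V finite_nbrs by fastforce
qed

end

text \<open>
  Cloning one end of the edge \<open>u w\<close> onto \<open>v\<close> keeps the weight maximal but destroys the edge,
  and then cloning the other end would gain weight.
\<close>

lemma zykov_trans:
  fixes a :: "nat \<Rightarrow> real" and E :: "'a \<Rightarrow> 'a \<Rightarrow> bool" and V :: "'a set" and p :: nat
  assumes E: "sgraph E" and V: "finite V" and free: "kcliques E (Suc p) V = {}"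
    and max: "\<And>E'. sgraph E' \<Longrightarrow> kcliques E' (Suc p) V = {} \<Longrightarrow> wt a E' V \<le> wt a E V"
    and nz: "\<And>E (X :: 'a set). finite X \<Longrightarrow> wt (\<lambda>j. a (Suc (Suc j))) E X \<noteq> 0"
    and uvw: "u \<in> V" "v \<in> V" "w \<in> V" and n: "\<not> E u v" "\<not> E v w"
  shows "\<not> E u w"
proof
  assume uw: "E u w"
  note sym = sgraph_sym[OF E] and irr = sgraph_irrefl[OF E]
  note ctx = E V free max nz
  have ne: "u \<noteq> v" "v \<noteq> w" "u \<noteq> w" using uw n irr sym by auto
  define F where "F = clone u v E"
  have F: "sgraph F" "kcliques F (Suc p) V = {}"
    unfolding F_def using sgraph_clone[OF E] clone_kfree[OF E uvw(2) free] by auto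
  have n': "\<not> E v u" "\<not> E w v" using n sym by auto
  have m: "wt (\<lambda>j. a (Suc j)) E (nbrs E V u) = wt (\<lambda>j. a (Suc j)) E (nbrs E V v)"
    "wt (\<lambda>j. a (Suc j)) E (nbrs E V w) = wt (\<lambda>j. a (Suc j)) E (nbrs E V v)"
    using zykov_nonadjacent_le[OF ctx uvw(1,2) n(1)] zykov_nonadjacent_le[OF ctx uvw(2,1) n'(1)]
      zykov_nonadjacent_le[OF ctx uvw(2,3) n(2)] zykov_nonadjacent_le[OF ctx uvw(3,2) n'(2)] by auto
  have "nbrs E (V - {u}) v = nbrs E V v" using n' by (auto simp: nbrs_def)
  then have "wt a F V = wt a E V"
    unfolding F_def using wt_clone[OF E V uvw(1), of v a] wt_remove[OF E uvw(1) V, of a] m(1) ne by simp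
  then have maxF: "wt a E' V \<le> wt a F V" if "sgraph E'" "kcliques E' (Suc p) V = {}" for E'
    using max[OF that] by simp
  have "\<not> F v w" using n ne by (auto simp: F_def clone_def)
  from zykov_nonadjacent_le[OF F(1) V F(2) maxF nz uvw(2,3) this]
  have "wt (\<lambda>j. a (Suc j)) F (nbrs F V v) \<le> wt (\<lambda>j. a (Suc j)) F (nbrs F V w)" by simp
  also have "wt (\<lambda>j. a (Suc j)) F (nbrs F V v) = wt (\<lambda>j. a (Suc j)) E (nbrs E V v)"
    by (rule wt_cong) (use n' irr ne in \<open>auto simp: F_def clone_def nbrs_def split: if_splits\<close>)
  also have "wt (\<lambda>j. a (Suc j)) F (nbrs F V w) = wt (\<lambda>j. a (Suc j)) E (nbrs E V w - {u})"
    by (rule wt_cong) (use n' irr ne in \<open>auto simp: F_def clone_def nbrs_def split: if_splits\<close>)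
  also have "\<dots> = wt (\<lambda>j. a (Suc j)) E (nbrs E V w)
      - wt (\<lambda>j. a (Suc (Suc j))) E (nbrs E (nbrs E V w) u)"
    using wt_remove[OF E, of u "nbrs E V w" "\<lambda>j. a (Suc j)"] V finite_nbrs[OF V] uvw sym[OF uw]
    by (simp add: nbrs_def)
  also have "\<dots> < wt (\<lambda>j. a (Suc j)) E (nbrs E V w)"
    using zykov_edge[OF ctx uvw(3,1) sym[OF uw]] by simp
  finally show False using m by simp
qed

text \<open>By \<open>zykov_trans\<close>, nonadjacency is an equivalence relation, so the graph is
  complete multipartite, and comparing adjacent vertices balances the classes. A
  \<open>p\<close>-clique fixes the number of classes; without one, the graph turns out to be
  complete on fewer than \<open>p\<close> vertices.\<close>

lemma zykov_max:
  fixes a :: "nat \<Rightarrow> real" and E :: "'a \<Rightarrow> 'a \<Rightarrow> bool" and V :: "'a set" and p :: nat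
  assumes E: "sgraph E" and V: "finite V" and free: "kcliques E (Suc p) V = {}"
    and max: "\<And>E'. sgraph E' \<Longrightarrow> kcliques E' (Suc p) V = {} \<Longrightarrow> wt a E' V \<le> wt a E V"
    and nz: "\<And>E (X :: 'a set). finite X \<Longrightarrow> wt (\<lambda>j. a (Suc (Suc j))) E X \<noteq> 0"
    and pos: "\<And>j. a (Suc (Suc (Suc j))) \<ge> 0"
    and edge: "u0 \<in> V" "v0 \<in> V" "E u0 v0"
  shows "\<exists>col. balanced col V {..<p} \<and> (\<forall>x\<in>V. \<forall>y\<in>V. E x y \<longleftrightarrow> col x \<noteq> col y)"
proof -
  note sym = sgraph_sym[OF E] and irr = sgraph_irrefl[OF E]
  note ctx = E V free max nz
  note trans = zykov_trans[OF ctx]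
  define cls where "cls x = {y \<in> V. \<not> E x y}" for x
  have fin: "finite (cls x)" for x using V by (simp add: cls_def)
  have cls_eq: "cls x = cls y" if "x \<in> V" "y \<in> V" "\<not> E x y" for x y
    unfolding cls_def using trans that sym by blast
  have disj: "cls x \<inter> cls y = {}" if "x \<in> V" "y \<in> V" "E x y" for x y
    unfolding cls_def using trans that sym by blast
  have full: "E s z" if "x \<in> V" "y \<in> V" "s \<in> cls x" "z \<in> cls y" "E x y" for x y s z
    using trans that sym unfolding cls_def by (metis (mono_tags, lifting) mem_Collect_eq)
  have nb: "nbrs E V x = V - cls x" for x by (auto simp: nbrs_def cls_def)
  have nb2: "nbrs E (nbrs E V x) y = V - cls x - cls y" for x y by (auto simp: nbrs_def cls_def)
  have join: "wt b E (V - cls x) = wt b E (V - cls x - cls y)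
      + card (cls y) * wt (\<lambda>j. b (Suc j)) E (V - cls x - cls y)"
    if xy: "x \<in> V" "y \<in> V" "E x y" for x y b
  proof -
    have U: "V - cls x = (V - cls x - cls y) \<union> cls y"
      using disj[OF xy] by (auto simp: cls_def)
    have nbz: "nbrs E ((V - cls x - cls y) \<union> cls y) z = V - cls x - cls y" if "z \<in> cls y" for z
    proof -
      have z: "z \<in> V" "\<not> E y z" using that by (auto simp: cls_def)
      have "cls z = cls y" using cls_eq[of y z] z xy by auto
      then show ?thesis unfolding U[symmetric] using nb2[of x z] unfolding nb[of x] by simp
    qed
    show ?thesis
      by (subst U, rule wt_join_independent[OF E fin _ _ nbz]) (use V in auto)
  qed
  \<comment> \<open>Either link weight is a common term plus the size of the other class times the
    edge weight \<open>?w\<close>, so dividing \<open>zykov_adjacent_le\<close> by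
    \<open>?w > 0\<close> compares the class sizes.\<close>
  have bal: "card (cls x) \<le> card (cls y) + 1" if xy: "x \<in> V" "y \<in> V" "E x y" for x y
  proof -
    let ?w = "wt (\<lambda>j. a (Suc (Suc j))) E (V - cls x - cls y)"
    have w: "?w > 0" using zykov_edge[OF ctx xy] nb2 by simp
    have "nbrs E (nbrs E V y) x = V - cls x - cls y" using nb2[of y x] by auto
    then have "wt (\<lambda>j. a (Suc j)) E (V - cls y) \<le> wt (\<lambda>j. a (Suc j)) E (V - cls x) + ?w"
      using zykov_adjacent_le[OF ctx xy(2,1) sym[OF xy(3)]] nb by simp
    moreover have "V - cls y - cls x = V - cls x - cls y" by auto
    ultimately have "card (cls x) * ?w \<le> card (cls y) * ?w + ?w"
      using join[OF xy, of "\<lambda>j. a (Suc j)"] join[OF xy(2,1) sym[OF xy(3)], of "\<lambda>j. a (Suc j)"] by simp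
    then have "real (card (cls x)) * ?w \<le> real (card (cls y) + 1) * ?w" by (simp add: algebra_simps)
    then show ?thesis using w by simp
  qed
  show ?thesis
  proof (cases "kcliques E p V = {}")
    case True
    have complete: "E x z" if xz: "x \<in> V" "z \<in> V" "x \<noteq> z" for x z
    proof (rule ccontr)
      assume nx: "\<not> E x z"
      \<comment> \<open>An isolated \<open>x\<close> would be nonadjacent to both \<open>u0\<close>
        and \<open>v0\<close>, against transitivity.\<close>
      obtain y where y: "y \<in> V" "E x y" using edge trans[of u0 x v0] xz sym by blast
      let ?F = "\<lambda>s t. E s t \<or> {s, t} = {x, z}"
      have F: "sgraph ?F"
        using xz irr sym by (intro sgraphI) (auto simp: doubleton_eq_iff)
      have "kcliques ?F (Suc p) V = {}"
      proof (rule equals0I)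
        fix S assume S: "S \<in> kcliques ?F (Suc p) V"
        \<comment> \<open>Dropping \<open>x\<close> if it lies in \<open>S\<close>, and any vertex
          otherwise, leaves a \<open>p\<close>-clique of \<open>E\<close>, because the added edge
          contains \<open>x\<close>.\<close>
        obtain s where s: "s \<in> S" "x \<in> S \<longrightarrow> s = x"
          using S unfolding kcliques_def by (cases "x \<in> S") (auto, metis card.empty ex_in_conv nat.distinct(1))
        then have "S - {s} \<in> kcliques E p V"
          using S by (auto simp: kcliques_def cliques_def doubleton_eq_iff)
        then show False using True by simp
      qed
      \<comment> \<open>Joining the twins \<open>x\<close> and \<open>z\<close> gains the shifted
        weight of \<open>V - cls x\<close>. By \<open>join\<close> this is the positive weight of
        the edge \<open>x y\<close> plus a term that is nonnegative by \<open>pos\<close>, so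
        maximality fails.\<close>
      then have "wt (\<lambda>j. a (Suc (Suc j))) E (nbrs E (nbrs E V x) z) \<le> 0"
        using max[OF F] wt_add_edge[OF E V xz nx, of a] by simp
      moreover have "nbrs E (nbrs E V x) z = V - cls x" using nb2[of x z] cls_eq[of x z] xz nx by auto
      moreover have "wt (\<lambda>j. a (Suc (Suc j))) E (V - cls x - cls y) > 0"
        using zykov_edge[OF ctx xz(1) y] nb2 by simp
      moreover have "wt (\<lambda>j. a (Suc (Suc (Suc j)))) E (V - cls x - cls y) \<ge> 0"
        by (rule wt_nonneg) (rule pos)
      ultimately show False using join[OF xz(1) y, of "\<lambda>j. a (Suc (Suc j))"]
        by (smt (verit) mult_nonneg_nonneg of_nat_0_le_iff)
    qed
    have "card V < p"
    proof (rule ccontr)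
      assume "\<not> card V < p"
      then obtain S where "S \<subseteq> V" "card S = p" "finite S"
        by (metis V not_less obtain_subset_with_card_n finite_subset)
      then have "S \<in> kcliques E p V" using complete by (auto simp: kcliques_def cliques_def)
      then show False using True by simp
    qed
    then obtain col where col: "inj_on col V" "col ` V \<subseteq> {..<p}"
      using card_le_inj[OF V, of "{..<p}"] by auto
    have "card {x \<in> V. col x = i} \<le> 1" for i
      using col(1) V by (intro card_le_Suc0_iff_eq[THEN iffD2, THEN order_trans]) (auto dest: inj_onD)
    then have "balanced col V {..<p}" using col V unfolding balanced_def
      by (auto intro: order_trans)
    moreover have "\<forall>x\<in>V. \<forall>y\<in>V. E x y \<longleftrightarrow> col x \<noteq> col y"
      using complete col(1) irr by (metis inj_onD)
    ultimately show ?thesis by blast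
  next
    case False
    then obtain S where S: "S \<subseteq> V" "finite S" "card S = p" "\<And>x y. x \<in> S \<Longrightarrow> y \<in> S \<Longrightarrow> x \<noteq> y \<Longrightarrow> E x y"
      by (auto simp: kcliques_def cliques_def)
    \<comment> \<open>Every vertex shares its class with a vertex of the \<open>p\<close>-clique, so
      the clique vertices can serve as colours.\<close>
    have "\<exists>s\<in>S. \<not> E x s" if "x \<in> V" for x
    proof (rule ccontr)
      assume *: "\<not> (\<exists>s\<in>S. \<not> E x s)"
      then have "x \<notin> S" using irr by auto
      then have "insert x S \<in> kcliques E (Suc p) V"
        using * S that sym by (auto simp: kcliques_def cliques_def)
      then show False using free by simp
    qed
    then obtain s where s: "\<And>x. x \<in> V \<Longrightarrow> s x \<in> S \<and> \<not> E x (s x)" by metis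
    obtain h where h: "bij_betw h S {..<p}"
      using S by (metis card_lessThan finite_lessThan finite_same_card_bij)
    have iff: "E x y \<longleftrightarrow> h (s x) \<noteq> h (s y)" if "x \<in> V" "y \<in> V" for x y
    proof -
      have "h (s x) = h (s y) \<longleftrightarrow> s x = s y"
        using h s that by (metis bij_betw_inv_into_left)
      moreover have "s x = s y \<Longrightarrow> \<not> E x y" using trans[of x "s x" y] s that S sym by (metis subsetD)
      moreover have "s x = s y" if "\<not> E x y"
      proof (rule ccontr)
        assume "s x \<noteq> s y"
        then have "E (s x) (s y)" using S s \<open>x \<in> V\<close> \<open>y \<in> V\<close> by blast
        moreover have "\<not> E (s x) y" using trans[of "s x" x y] s[of x] that S sym \<open>x \<in> V\<close> \<open>y \<in> V\<close> by blast
        ultimately show False using trans[of "s x" y "s y"] s S \<open>x \<in> V\<close> \<open>y \<in> V\<close> by blast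
      qed
      ultimately show ?thesis by blast
    qed
    have cl: "{x \<in> V. h (s x) = h i} = cls i" if "i \<in> S" for i
    proof -
      have iV: "i \<in> V" using that S by auto
      have "s i = i" using s[OF iV] S(4)[OF that, of "s i"] by metis
      then have "E i y \<longleftrightarrow> h (s y) \<noteq> h i" if "y \<in> V" for y using iff[OF iV that] by metis
      then show ?thesis unfolding cls_def by blast
    qed
    have "card {x \<in> V. h (s x) = i} \<le> card {x \<in> V. h (s x) = j} + 1" if "i < p" "j < p" for i j
    proof -
      have "i \<in> h ` S" "j \<in> h ` S" using that unfolding bij_betw_imp_surj_on[OF h] by simp_all
      then obtain i' j' where ij: "i' \<in> S" "j' \<in> S" "i = h i'" "j = h j'"
        by (elim imageE) (rule that)
      show ?thesis
      proof (cases "i' = j'")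
        case False
        then have "E i' j'" using S(4) ij by metis
        moreover have "i' \<in> V" "j' \<in> V" using ij S(1) by auto
        ultimately show ?thesis using bal[of i' j'] unfolding ij(3,4) cl[OF ij(1)] cl[OF ij(2)] by simp
      qed (use ij in simp)
    qed
    moreover have "(\<lambda>x. h (s x)) ` V \<subseteq> {..<p}"
      using h s by (auto dest: bij_betwE)
    ultimately have "balanced (\<lambda>x. h (s x)) V {..<p}" using V by (auto simp: balanced_def)
    then show ?thesis using iff by blast
  qed
qed

section \<open>Balanced complete multipartite graphs\<close>

text \<open>
  The number of \<open>m\<close>-cliques of the balanced complete \<open>p\<close>-partite graph on \<open>n\<close> vertices. The
  recursion deletes a vertex \<open>x\<close> of a largest part of a graph on \<open>n + 1\<close> vertices: that part has
  \<open>n div p + 1\<close> vertices, and the neighbours of \<open>x\<close> form a balanced \<open>(p - 1)\<close>-partite graph.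
\<close>

fun tau :: "nat \<Rightarrow> nat \<Rightarrow> nat \<Rightarrow> nat" where
  "tau 0 n p = 1"
| "tau (Suc m) 0 p = 0"
| "tau (Suc m) (Suc n) p = tau (Suc m) n p + tau m (n - n div p) (p - 1)"

lemma card_kcliques_balanced:
  assumes "balanced col V I"
  shows "card (kcliques (\<lambda>x y. col x \<noteq> col y) m V) = tau m (card V) (card I)"
  using assms
proof (induction m "card V" "card I" arbitrary: V I rule: tau.induct)
  case 1
  then show ?case by (simp add: kcliques_0)
next
  case (2 m)
  then have "V = {}" by (auto simp: balanced_def)
  then have "kcliques (\<lambda>x y. col x \<noteq> col y) (Suc m) V = {}"
    by (auto simp: kcliques_def cliques_def)
  then show ?case using 2 by simp
next
  case (3 m n)
  let ?E = "\<lambda>x y. col x \<noteq> col y"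
  define f where "f i = card {x \<in> V. col x = i}" for i
  have fin: "finite V" "finite I" and col: "col ` V \<subseteq> I"
    and bal: "\<And>i j. i \<in> I \<Longrightarrow> j \<in> I \<Longrightarrow> f i \<le> f j + 1"
    using 3(4) by (auto simp: balanced_def f_def)
  have "V \<noteq> {}" using 3(3) by auto
  then have I: "I \<noteq> {}" using col by auto
  then have "Max (f ` I) \<in> f ` I" using fin by simp
  then obtain i where i: "i \<in> I" "f i = Max (f ` I)" by auto
  have max: "f j \<le> f i" if "j \<in> I" for j using i fin that by simp
  have cV: "card V = (\<Sum>j\<in>I. f j)"
    using sum.group[OF fin col, of "\<lambda>_. 1 :: nat"] by (simp add: f_def)
  have f0: "f i > 0"
  proof (rule ccontr)
    assume "\<not> f i > 0"
    then have "f j = 0" if "j \<in> I" for j using max[OF that] by simp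
    then show False using cV 3(3) by simp
  qed
  have "card V \<le> card I * f i"
    unfolding cV using sum_bounded_above[of I f "f i"] max by simp
  moreover have "card V \<ge> card I * (f i - 1) + 1"
  proof -
    have "(\<Sum>j\<in>I - {i}. f j) \<ge> card (I - {i}) * (f i - 1)"
      using sum_bounded_below[of "I - {i}" "f i - 1" f] bal[OF i(1)] by (simp add: le_diff_conv)
    moreover have "card I = card (I - {i}) + 1" using card_Suc_Diff1[OF fin(2) i(1)] by simp
    ultimately show ?thesis unfolding cV sum.remove[OF fin(2) i(1)] using f0 by simp
  qed
  \<comment> \<open>Since \<open>card V\<close> is above \<open>card I * (f i - 1)\<close> and at
    most \<open>card I * f i\<close>, subtracting one gives the quotient \<open>f i - 1\<close>,
    matching the recursion of \<open>tau\<close>.\<close>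
  ultimately have dv: "n div card I = f i - 1"
    using f0 3(3)[symmetric] by (intro div_nat_eqI) auto
  obtain x where x: "x \<in> V" "col x = i"
    using f0 by (auto simp: f_def card_gt_0_iff)
  have rem: "card {y \<in> V - {x}. col y = j} = (if j = i then f i - 1 else f j)" for j
  proof -
    have "{y \<in> V - {x}. col y = j} = (if j = i then {y \<in> V. col y = i} - {x} else {y \<in> V. col y = j})"
      using x by auto
    then show ?thesis using x fin by (simp add: f_def)
  qed
  have "f i \<le> f j + 1" "f j \<le> f i" "f i - 1 + 1 = f i" if "j \<in> I" for j
    using max bal[OF i(1)] f0 that by auto
  then have "balanced col (V - {x}) I"
    unfolding balanced_def rem using fin col by (force simp: le_diff_conv)
  moreover have "card (V - {x}) = n" using 3(3) x fin by (simp add: card_Diff_singleton)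
  ultimately have 1: "card (kcliques ?E (Suc m) (V - {x})) = tau (Suc m) n (card I)"
    using 3(1)[of "V - {x}" I] by simp
  have nb: "nbrs ?E V x = V - {y \<in> V. col y = i}" using x by (auto simp: nbrs_def)
  have cls: "{y \<in> nbrs ?E V x. col y = j} = {y \<in> V. col y = j}" if "j \<noteq> i" for j
    using that nb by auto
  have "balanced col (nbrs ?E V x) (I - {i})"
    unfolding balanced_def
  proof (intro conjI ballI)
    fix j k assume "j \<in> I - {i}" "k \<in> I - {i}"
    then show "card {y \<in> nbrs ?E V x. col y = j} \<le> card {y \<in> nbrs ?E V x. col y = k} + 1"
      using bal cls by (simp add: f_def)
  qed (use fin col x in \<open>auto simp: nbrs_def\<close>)
  moreover have "card (nbrs ?E V x) = n - n div card I"
    unfolding nb dv using 3(3) fin f0 by (subst card_Diff_subset) (auto simp: f_def)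
  moreover have "card (I - {i}) = card I - 1" using i fin by (simp add: card_Diff_singleton)
  ultimately have "card (kcliques ?E m (nbrs ?E V x)) = tau m (n - n div card I) (card I - 1)"
    using 3(2)[of "nbrs ?E V x" "I - {i}"] by simp
  moreover have "sgraph ?E" by (intro sgraphI) auto
  ultimately show ?case
    using card_kcliques_remove[of ?E x V m] x fin 1 3(3)[symmetric] by simp
qed

section \<open>Clique bounds from symmetrization\<close>

lemma zykov_wt:
  fixes a :: "nat \<Rightarrow> real" and V :: "'a set"
  assumes G: "sgraph G" "finite V" "kcliques G (Suc p) V = {}"
    and nz: "\<And>E (X :: 'a set). finite X \<Longrightarrow> wt (\<lambda>j. a (Suc (Suc j))) E X \<noteq> 0"
    and pos: "\<And>j. a (Suc (Suc (Suc j))) \<ge> 0"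
  shows "wt a G V \<le> wt a (\<lambda>_ _. False) V \<or>
    (\<exists>col. balanced col V {..<p} \<and> wt a G V \<le> wt a (\<lambda>x y. col x \<noteq> col y) V)"
proof -
  let ?S = "{E. sgraph E \<and> kcliques E (Suc p) V = {}}"
  let ?W = "(\<lambda>E. wt a E V) ` ?S"
  \<comment> \<open>There may be infinitely many relations \<open>E\<close>, but only finitely many
    families of cliques on \<open>V\<close>, so the maximum is attained.\<close>
  have "?W \<subseteq> (\<lambda>F. \<Sum>S\<in>F. a (card S)) ` Pow (Pow V)"
  proof
    fix y assume "y \<in> ?W"
    then obtain E where "y = wt a E V" by auto
    moreover have "cliques E V \<in> Pow (Pow V)" by (auto simp: cliques_def)
    ultimately show "y \<in> (\<lambda>F. \<Sum>S\<in>F. a (card S)) ` Pow (Pow V)" by (auto simp: wt_def)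
  qed
  then have fin: "finite ?W" by (rule finite_subset) (use G in auto)
  moreover have "?W \<noteq> {}" using G by auto
  ultimately have "Max ?W \<in> ?W" by (rule Max_in)
  then obtain E where E: "sgraph E" "kcliques E (Suc p) V = {}" "wt a E V = Max ?W" by auto
  have max: "wt a E' V \<le> wt a E V" if "sgraph E'" "kcliques E' (Suc p) V = {}" for E'
    using that fin E by simp
  show ?thesis
  proof (cases "\<exists>u\<in>V. \<exists>v\<in>V. E u v")
    case True
    then obtain u v where "u \<in> V" "v \<in> V" "E u v" by blast
    from zykov_max[OF E(1) G(2) E(2) max nz pos this]
    obtain col where "balanced col V {..<p}" "\<forall>x\<in>V. \<forall>y\<in>V. E x y \<longleftrightarrow> col x \<noteq> col y" by blast
    moreover from this have "wt a E V = wt a (\<lambda>x y. col x \<noteq> col y) V" by (intro wt_cong) auto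
    ultimately show ?thesis using max[OF G(1,3)] by metis
  next
    case False
    then have "wt a E V = wt a (\<lambda>_ _. False) V" by (intro wt_cong) auto
    then show ?thesis using max[OF G(1,3)] by simp
  qed
qed

text \<open>An edge contributes the number of \<open>(r - 2)\<close>-cliques in its common
  neighbourhood minus \<beta>, which is nonzero as \<beta> is no integer; hence
  \<open>zykov_wt\<close> applies. The value 0 belongs to the edgeless graph.\<close>

lemma zykov_penalized:
  fixes V :: "'a set" and \<beta> :: real
  assumes G: "sgraph G" "finite V" "kcliques G (Suc p) V = {}" and r: "r \<ge> 2" and \<beta>: "\<beta> \<notin> \<int>"
  shows "card (kcliques G r V) - \<beta> * card (kcliques G 2 V)
    \<le> max 0 (tau r (card V) p - \<beta> * tau 2 (card V) p)"
proof -
  define a :: "nat \<Rightarrow> real" where "a = (\<lambda>j. of_bool (j = r) - \<beta> * of_bool (j = 2))"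
  have wta: "wt a E X = card (kcliques E r X) - \<beta> * card (kcliques E 2 X)"
    if "finite X" for E :: "'a \<Rightarrow> 'a \<Rightarrow> bool" and X
    unfolding card_kcliques_wt[OF that] a_def wt_def by (simp add: sum_subtractf sum_distrib_left)
  have "wt (\<lambda>j. a (Suc (Suc j))) E X \<noteq> 0" if X: "finite X" for E and X :: "'a set"
  proof -
    have *: "a (Suc (Suc j)) = of_bool (j = r - 2) - \<beta> * of_bool (j = 0)" for j
      using r by (auto simp: a_def)
    have "wt (\<lambda>j. a (Suc (Suc j))) E X = card (kcliques E (r - 2) X) - \<beta> * card (kcliques E 0 X)"
      unfolding card_kcliques_wt[OF X] * wt_def by (simp add: sum_subtractf sum_distrib_left)
    also have "\<dots> = card (kcliques E (r - 2) X) - \<beta>" by (simp add: kcliques_0)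
    also have "\<dots> \<noteq> 0" using \<beta> by (metis Ints_of_nat eq_iff_diff_eq_0)
    finally show ?thesis .
  qed
  moreover have "a (Suc (Suc (Suc j))) \<ge> 0" for j by (simp add: a_def)
  ultimately consider "wt a G V \<le> wt a (\<lambda>_ _. False) V"
    | col where "balanced col V {..<p}" "wt a G V \<le> wt a (\<lambda>x y. col x \<noteq> col y) V"
    using zykov_wt[OF G, of a] by blast
  then show ?thesis
  proof cases
    case 1
    have "kcliques (\<lambda>_ _. False) j V = {}" if "j \<ge> 2" for j
    proof (rule equals0I)
      fix S assume S: "S \<in> kcliques (\<lambda>_ _. False) j V"
      then have "card S \<ge> 2" using that by (simp add: kcliques_def)
      then obtain x y where "x \<in> S" "y \<in> S" "x \<noteq> y"
        by (metis card_2_iff' obtain_subset_with_card_n subsetD)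
      then show False using S by (auto simp: kcliques_def cliques_def)
    qed
    then have "wt a (\<lambda>_ _. False) V = 0" using wta[OF G(2)] r by simp
    then show ?thesis using 1 wta[OF G(2)] by simp
  next
    case 2
    then show ?thesis using wta[OF G(2)] card_kcliques_balanced[OF 2(1)] by simp
  qed
qed

lemma notin_Ints_add_frac:
  fixes e :: real
  assumes "0 < e" "e < 1"
  shows "real c + e \<notin> \<int>"
proof
  assume "real c + e \<in> \<int>"
  then have "real c + e - real c \<in> \<int>" by (intro Ints_diff) auto
  then obtain i :: int where "e = of_int i" by (auto elim: Ints_cases)
  then show False using assms by auto
qed

text \<open>A penalty \<open>e\<close> per edge with \<open>e * K < 1\<close> makes
  \<open>zykov_penalized\<close> applicable and is then removed by integrality of the
  counts.\<close>

lemma zykov_card_kcliques: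
  fixes V :: "'a set"
  assumes G: "sgraph G" "finite V" "kcliques G (Suc p) V = {}" and r: "r \<ge> 2"
  shows "card (kcliques G r V) \<le> tau r (card V) p"
proof -
  define K where "K = card (kcliques G 2 V)"
  define e where "e = 1 / (real K + 2)"
  have e: "0 < e" "e < 1" "e * K < 1" by (auto simp: e_def)
  have "card (kcliques G r V) - e * K \<le> max 0 (tau r (card V) p - e * tau 2 (card V) p)"
    using zykov_penalized[OF G r notin_Ints_add_frac[OF e(1,2), of 0]] by (simp add: K_def)
  also have "\<dots> \<le> tau r (card V) p" using e by simp
  finally show ?thesis using e by linarith
qed

text \<open>The penalty is \<open>c + e\<close> with tiny \<open>e\<close>. By \<open>big\<close>
  the multipartite value is nonnegative, so the edgeless alternative disappears, and integrality
  removes \<open>e\<close>.\<close>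

lemma zykov_card_kcliques_penalized:
  fixes V :: "'a set"
  assumes G: "sgraph G" "finite V" "kcliques G (Suc p) V = {}" and r: "r \<ge> 2"
    and big: "(c + 1) * tau 2 (card V) p \<le> tau r (card V) p"
  shows "card (kcliques G r V) + c * tau 2 (card V) p \<le> tau r (card V) p + c * card (kcliques G 2 V)"
proof -
  define K where "K = card (kcliques G 2 V)"
  define T where "T = tau 2 (card V) p"
  define e where "e = 1 / (real K + 2)"
  have e: "0 < e" "e < 1" "e * K < 1" by (auto simp: e_def)
  have "(c + e) * T \<le> real (c + 1) * T" using e by (intro mult_right_mono) auto
  also have "\<dots> \<le> tau r (card V) p" using big unfolding T_def by (metis of_nat_le_iff of_nat_mult)
  finally have "card (kcliques G r V) - (c + e) * K \<le> tau r (card V) p - (c + e) * T"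
    using zykov_penalized[OF G r notin_Ints_add_frac[OF e(1,2), of c]] by (simp add: K_def T_def)
  moreover have "0 \<le> e * T" using e by simp
  ultimately have "card (kcliques G r V) + real c * T < tau r (card V) p + real c * K + 1"
    using e(3) unfolding distrib_right by linarith
  then have "real (card (kcliques G r V) + c * T) < real (tau r (card V) p + c * K + 1)" by simp
  then show ?thesis unfolding of_nat_less_iff K_def T_def by simp
qed

section \<open>Growth of \<open>tau\<close>\<close>

lemma tau_Suc_0: "tau (Suc 0) n p = n"
  by (induction n) auto

lemma tau_mono: "n \<le> n' \<Longrightarrow> tau m n p \<le> tau m n' p"
proof (induction n' rule: dec_induct)
  case (step n')
  then show ?case by (cases m) auto
qed simp

lemma le_diff_div:
  fixes n :: nat
  assumes "m \<le> n" "Suc m \<le> p"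
  shows "m \<le> n - n div p"
proof (cases "n < p")
  case False
  then have "n div p \<ge> 1" using assms by (simp add: div_greater_zero_iff Suc_leI)
  then have "p - 1 \<le> n div p * (p - 1)" by simp
  also have "\<dots> = n div p * p - n div p" by (simp add: diff_mult_distrib2)
  also have "\<dots> \<le> n - n div p" by (intro diff_le_mono) (simp add: div_times_less_eq_dividend)
  finally show ?thesis using assms by simp
qed (use assms in simp)

lemma tau_pos: "m \<le> p \<Longrightarrow> m \<le> n \<Longrightarrow> 1 \<le> tau m n p"
proof (induction m n p rule: tau.induct)
  case (3 m n p)
  then have "1 \<le> tau m (n - n div p) (p - 1)" by (simp add: le_diff_div)
  then show ?case by simp
qed auto

text \<open>Once \<open>m - 1\<close> vertices are present, every further vertex adds at least one
  \<open>m\<close>-clique.\<close>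

lemma tau_ge: "1 \<le> m \<Longrightarrow> m \<le> p \<Longrightarrow> n + 1 \<le> tau m n p + m"
proof (induction n)
  case (Suc n)
  obtain m' where m: "m = Suc m'" using Suc.prems by (cases m) auto
  show ?case
  proof (cases "n < m'")
    case False
    then have "1 \<le> tau m' (n - n div p) (p - 1)"
      using Suc.prems m by (intro tau_pos le_diff_div) auto
    then show ?thesis using Suc m by simp
  qed (use m in simp)
qed simp

lemma diff_div_ge:
  fixes n :: nat
  assumes "p \<ge> 2"
  shows "n \<le> 2 * (n - n div p)"
proof -
  have "n div p \<le> n div 2" using assms by (intro div_le_mono2) auto
  then show ?thesis by linarith
qed

text \<open>A new vertex sees at least half of the old ones, and \<open>tau_ge\<close> counts the
  \<open>(m - 1)\<close>-cliques among these; doubling avoids fractions.\<close>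

lemma tau_step_ge:
  assumes "2 \<le> m" "m \<le> q"
  shows "2 * tau m y q + y + 2 \<le> 2 * tau m (Suc y) q + 2 * m"
proof -
  obtain m' where m: "m = Suc m'" "1 \<le> m'" using assms by (cases m) auto
  have "y - y div q + 1 \<le> tau m' (y - y div q) (q - 1) + m'"
    using assms m by (intro tau_ge) auto
  then show ?thesis using diff_div_ge[of q y] assms m by simp
qed

text \<open>The extra 1 per step eventually absorbs the initial value, however negative.\<close>

lemma eventually_ge_linear:
  fixes u :: "nat \<Rightarrow> int"
  assumes "\<forall>\<^sub>F n in sequentially. u (Suc n) \<ge> u n + (C + 1)"
  shows "\<forall>\<^sub>F n in sequentially. u n \<ge> C * n"
proof -
  obtain N where N: "\<And>n. n \<ge> N \<Longrightarrow> u (Suc n) \<ge> u n + (C + 1)"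
    using assms by (auto simp: eventually_sequentially)
  have *: "u n \<ge> u N + (C + 1) * (int n - int N)" if "n \<ge> N" for n
    using that
  proof (induction n rule: dec_induct)
    case (step n)
    then show ?case using N[of n] by (simp add: algebra_simps)
  qed simp
  have "u n \<ge> C * n" if "n \<ge> N + nat \<bar>(C + 1) * N - u N\<bar>" for n
    using *[of n] that by (simp add: algebra_simps)
  then show ?thesis by (auto simp: eventually_sequentially)
qed

lemma eventually_tau_ge:
  assumes "2 \<le> m" "m \<le> q"
  shows "\<forall>\<^sub>F n in sequentially. C * n \<le> tau m n q"
proof -
  have "int (tau m (Suc n) q) \<ge> int (tau m n q) + (int C + 1)" if "n \<ge> 2 * C + 2 * m" for n
    using tau_step_ge[OF assms, of n] that by simp
  then have "\<forall>\<^sub>F n in sequentially. int (tau m n q) \<ge> int C * int n"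
    by (intro eventually_ge_linear) (auto simp: eventually_sequentially)
  then show ?thesis by eventually_elim (metis of_nat_le_iff of_nat_mult)
qed

text \<open>Compare increments: \<open>tau 2\<close> grows by the number \<open>x\<close> of
  neighbours of the new vertex, \<open>tau r\<close> by \<open>tau (r - 1) x (p - 1)\<close>, which
  is superlinear in \<open>x\<close>.\<close>

lemma eventually_tau_dominates:
  assumes "3 \<le> r" "r \<le> p"
  shows "\<forall>\<^sub>F n in sequentially. C * tau 2 n p \<le> tau r n p"
proof -
  obtain N where N: "\<And>n. n \<ge> N \<Longrightarrow> (C + 1) * n \<le> tau (r - 1) n (p - 1)"
    using eventually_tau_ge[of "r - 1" "p - 1" "C + 1"] assms unfolding eventually_sequentially by force
  define u where "u n = int (tau r n p) - int (C * tau 2 n p)" for n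
  have "u (Suc n) \<ge> u n + (0 + 1)" if n: "n \<ge> 2 * N + 2" for n
  proof -
    define x where "x = n - n div p"
    have x: "x \<ge> N" "x \<ge> 1" using diff_div_ge[of p n] assms n by (auto simp: x_def)
    obtain r' where r': "r = Suc r'" using assms by (cases r) auto
    have "tau r (Suc n) p = tau r n p + tau (r - 1) x (p - 1)" by (simp add: r' x_def)
    moreover have "tau 2 (Suc n) p = tau 2 n p + x" by (simp add: numeral_2_eq_2 tau_Suc_0 x_def)
    moreover have "(C + 1) * x \<le> tau (r - 1) x (p - 1)" by (rule N[OF x(1)])
    ultimately have "C * tau 2 (Suc n) p + tau r n p + 1 \<le> tau r (Suc n) p + C * tau 2 n p"
      using x(2) by (simp add: algebra_simps)
    then show ?thesis unfolding u_def by linarith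
  qed
  then have "\<forall>\<^sub>F n in sequentially. u n \<ge> 0 * int n"
    by (intro eventually_ge_linear) (auto simp: eventually_sequentially)
  then show ?thesis by eventually_elim (simp add: u_def, metis of_nat_le_iff of_nat_mult)
qed

text \<open>Near \<open>x\<close> every vertex is worth at least order \<open>n\<close> cliques, so
  a deficit of at most \<open>K * n\<close> cliques means a bounded deficit of vertices.\<close>

lemma tau_drop:
  assumes "2 \<le> m" "m \<le> q"
  shows "\<exists>C. \<forall>\<^sub>F n in sequentially. \<forall>x d. n \<le> 2 * x \<longrightarrow> tau m x q \<le> tau m d q + K * n \<longrightarrow> x \<le> d + C"
proof -
  \<comment> \<open>In \<open>2 * tau\<close>, going up \<open>C\<close> steps to \<open>x\<close>
    gains about \<open>C * x\<close>, at least \<open>4 * (K + 1) * n\<close>, which beats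
    \<open>2 * K * n\<close>.\<close>
  define C where "C = 8 * (K + 1)"
  have "x \<le> d + C"
    if n: "n \<ge> C * C + 2 * C * m + 1" and x: "n \<le> 2 * x" and t: "tau m x q \<le> tau m d q + K * n" for n x d
  proof (rule ccontr)
    assume "\<not> x \<le> d + C"
    then have d: "d \<le> x - C" "C \<le> x" by auto
    have step: "2 * tau m (x - C) q + j * (x - C) \<le> 2 * tau m (x - C + j) q + j * (2 * m)" for j
    proof (induction j)
      case (Suc j)
      show ?case using tau_step_ge[OF assms, of "x - C + j"] Suc by simp
    qed simp
    have "2 * tau m d q + C * (x - C) \<le> 2 * tau m x q + C * (2 * m)"
      using step[of C] tau_mono[OF d(1), of m q] d(2) by simp
    also have "\<dots> \<le> 2 * tau m d q + 2 * K * n + C * (2 * m)" using t by simp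
    finally have "C * x \<le> 2 * K * n + 2 * C * m + C * C"
      using d(2) by (simp add: diff_mult_distrib2)
    moreover have "8 * (K + 1) * n \<le> 8 * (K + 1) * (2 * x)" using x by (intro mult_left_mono) auto
    ultimately show False using n by (simp add: C_def algebra_simps)
  qed
  then show ?thesis unfolding eventually_sequentially by blast
qed

section \<open>Graphs of almost extremal minimum degree\<close>

definition common_nbrs :: "('a \<Rightarrow> 'a \<Rightarrow> bool) \<Rightarrow> 'a set \<Rightarrow> 'a set \<Rightarrow> 'a set" where
  "common_nbrs E V X = {z \<in> V. \<forall>x\<in>X. E x z}"

definition nonedges :: "('a \<Rightarrow> 'a \<Rightarrow> bool) \<Rightarrow> 'a set \<Rightarrow> 'a set set" where
  "nonedges E V = [V]\<^bsup>2\<^esup> - cliques E V"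

text \<open>The nonedges whose addition creates no clique of size \<open>q + 2\<close>.\<close>

definition addable :: "nat \<Rightarrow> ('a \<Rightarrow> 'a \<Rightarrow> bool) \<Rightarrow> 'a set \<Rightarrow> 'a set set" where
  "addable q E V = {e \<in> nonedges E V. kcliques E q (common_nbrs E V e) = {}}"

definition score :: "nat \<Rightarrow> nat \<Rightarrow> nat \<Rightarrow> nat \<Rightarrow> ('a \<Rightarrow> 'a \<Rightarrow> bool) \<Rightarrow> 'a set \<Rightarrow> nat" where
  "score r c D q E V = card (kcliques E r V) + c * card (nonedges E V) + D * card (addable q E V)"

lemma finite_common_nbrs: "finite V \<Longrightarrow> finite (common_nbrs E V X)"
  by (simp add: common_nbrs_def)

lemma finite_nonedges: "finite V \<Longrightarrow> finite (nonedges E V)"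
  by (simp add: nonedges_def finite_imp_finite_nsets)

lemma finite_addable: "finite V \<Longrightarrow> finite (addable q E V)"
  by (simp add: addable_def finite_nonedges)

lemma card_nsets_choose:
  assumes "finite A"
  shows "card ([A]\<^bsup>k\<^esup>) = card A choose k"
proof -
  have "[A]\<^bsup>k\<^esup> = {S. S \<subseteq> A \<and> card S = k}"
    using assms by (auto simp: nsets_def intro: finite_subset)
  then show ?thesis using n_subsets[OF assms] by simp
qed

lemma card_nonedges:
  assumes "finite V"
  shows "card (nonedges E V) + card (kcliques E 2 V) = card V choose 2"
proof -
  have "nonedges E V \<union> kcliques E 2 V = [V]\<^bsup>2\<^esup>" "nonedges E V \<inter> kcliques E 2 V = {}"
    by (auto simp: nonedges_def kcliques_def nsets_def cliques_def)
  then show ?thesis using assms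
    by (metis card_Un_disjoint card_nsets_choose finite_kcliques finite_nonedges)
qed

text \<open>Choosing a vertex in one set removes at most \<open>K\<close> candidates from each other
  set, so sets larger than \<open>card J * K\<close> survive all choices.\<close>

lemma greedy_transversal:
  assumes "finite J" "\<And>y. y \<in> J \<Longrightarrow> finite (U y) \<and> card J * K < card (U y)"
    and "\<And>y y' z. y \<in> J \<Longrightarrow> y' \<in> J \<Longrightarrow> y \<noteq> y' \<Longrightarrow> z \<in> U y \<Longrightarrow> card {x \<in> U y'. \<not> E z x} \<le> K"
    and E: "sgraph E"
  shows "\<exists>S \<in> cliques E (\<Union>y\<in>J. U y). card S = card J"
  using assms(1-3)
proof (induction J arbitrary: U rule: finite_induct)
  case (insert j J)
  have fin: "finite (U y)" if "y \<in> insert j J" for y using insert.prems(1)[OF that] by simp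
  have "card (U j) > 0" using insert.prems(1)[of j] by simp
  then obtain z where z: "z \<in> U j" by (auto simp: card_gt_0_iff)
  define U' where "U' y = {x \<in> U y. E z x}" for y
  have U': "U' y \<subseteq> U y" "finite (U' y)" "card J * K < card (U' y)" if "y \<in> J" for y
  proof -
    have "U y = U' y \<union> {x \<in> U y. \<not> E z x}" "U' y \<inter> {x \<in> U y. \<not> E z x} = {}"
      by (auto simp: U'_def)
    then have "card (U y) = card (U' y) + card {x \<in> U y. \<not> E z x}"
      using fin[of y] that by (metis (no_types, lifting) card_Un_disjoint finite_Un insertI2)
    moreover have "card {x \<in> U y. \<not> E z x} \<le> K"
      using insert.prems(2)[of j y z] insert.hyps z that by auto
    moreover have "(card J + 1) * K < card (U y)"
      using insert.prems(1)[of y] insert.hyps that by simp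
    ultimately show "card J * K < card (U' y)" by simp
  qed (use fin that in \<open>auto simp: U'_def\<close>)
  have "\<exists>S\<in>cliques E (\<Union>y\<in>J. U' y). card S = card J"
  proof (rule insert.IH)
    fix y y' x assume *: "y \<in> J" "y' \<in> J" "y \<noteq> y'" "x \<in> U' y"
    have "card {u \<in> U' y'. \<not> E x u} \<le> card {u \<in> U y'. \<not> E x u}"
      using fin * U' by (intro card_mono) auto
    also have "\<dots> \<le> K" using insert.prems(2)[of y y' x] * U' by auto
    finally show "card {u \<in> U' y'. \<not> E x u} \<le> K" .
  qed (use U' in auto)
  then obtain S where S: "S \<in> cliques E (\<Union>y\<in>J. U' y)" "card S = card J" by blast
  have zS: "E z x" "E x z" if "x \<in> S" for x
    using S that sgraph_sym[OF E] by (auto simp: cliques_def U'_def)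
  have "z \<notin> S" using zS sgraph_irrefl[OF E] by blast
  moreover have "insert z S \<in> cliques E (\<Union>y\<in>insert j J. U y)"
  proof -
    have "(\<Union>y\<in>J. U' y) \<subseteq> (\<Union>y\<in>J. U y)" using U'(1) by (rule UN_mono[OF order_refl])
    then have "S \<subseteq> (\<Union>y\<in>J. U y)" using S(1) by (auto simp: cliques_def)
    then show ?thesis using S(1) z zS unfolding cliques_def by auto
  qed
  ultimately show ?case using S insert.hyps by (intro bexI[of _ "insert z S"]) (auto simp: cliques_def)
qed (auto simp: cliques_def)

context
  fixes E :: "'a \<Rightarrow> 'a \<Rightarrow> bool" and V :: "'a set" and p B :: nat
  assumes E: "sgraph E" and V: "finite V" and free: "kcliques E (Suc p) V = {}"
    and deg: "\<And>v. v \<in> V \<Longrightarrow> p * card {x \<in> V. \<not> E v x} \<le> card V + B"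
    and p: "p \<ge> 1"
begin

text \<open>The nonneighbours of at most \<open>p - 1\<close> vertices cover at most a fraction
  \<open>(p - 1) / p\<close> of \<open>V\<close>, up to a constant.\<close>

lemma card_common_nbrs_ge:
  assumes X: "X \<subseteq> V" "card X + 1 \<le> p" and n: "card V \<ge> p * L + p * B"
  shows "L \<le> card (common_nbrs E V X)"
proof -
  have fX: "finite X" using X V finite_subset by auto
  have "V - common_nbrs E V X \<subseteq> (\<Union>x\<in>X. {z \<in> V. \<not> E x z})" by (auto simp: common_nbrs_def)
  then have "card (V - common_nbrs E V X) \<le> card (\<Union>x\<in>X. {z \<in> V. \<not> E x z})"
    using fX V by (intro card_mono) auto
  also have "\<dots> \<le> (\<Sum>x\<in>X. card {z \<in> V. \<not> E x z})" by (rule card_UN_le[OF fX])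
  finally have "p * card (V - common_nbrs E V X) \<le> (\<Sum>x\<in>X. p * card {z \<in> V. \<not> E x z})"
    by (simp flip: sum_distrib_left)
  also have "\<dots> \<le> card X * (card V + B)"
    using sum_bounded_above[of X "\<lambda>x. p * card {z \<in> V. \<not> E x z}" "card V + B"] deg X by auto
  also have "\<dots> \<le> (p - 1) * (card V + B)" using X by (intro mult_right_mono) auto
  finally have 1: "p * card (V - common_nbrs E V X) + (card V + B) \<le> p * (card V + B)"
    using p by (cases p) auto
  have "card V = card (common_nbrs E V X) + card (V - common_nbrs E V X)"
  proof -
    have "common_nbrs E V X \<subseteq> V" by (auto simp: common_nbrs_def)
    then show ?thesis using V by (metis card_Diff_subset card_mono finite_subset le_add_diff_inverse)
  qed
  then have "p * card V = p * card (common_nbrs E V X) + p * card (V - common_nbrs E V X)"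
    by (metis add_mult_distrib2)
  with 1 have "card V \<le> p * card (common_nbrs E V X) + p * B" by (simp add: algebra_simps)
  then have "p * L \<le> p * card (common_nbrs E V X)" using n by linarith
  then show ?thesis using p by simp
qed

lemma clique_extension:
  assumes "X \<subseteq> V" "card X + s \<le> p" and n: "card V \<ge> p + p * B"
  shows "\<exists>S. S \<in> kcliques E s (common_nbrs E V X)"
  using assms(2)
proof (induction s)
  case (Suc s)
  then obtain S where S: "S \<in> kcliques E s (common_nbrs E V X)" by auto
  have "card (X \<union> S) + 1 \<le> p"
    using Suc.prems S card_Un_le[of X S] by (auto simp: kcliques_def)
  moreover have "X \<union> S \<subseteq> V" using S assms by (auto simp: kcliques_def cliques_def common_nbrs_def)
  ultimately have "1 \<le> card (common_nbrs E V (X \<union> S))"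
    by (intro card_common_nbrs_ge) (use n in auto)
  then obtain z where "z \<in> common_nbrs E V (X \<union> S)"
    by (metis card.empty ex_in_conv not_one_le_zero)
  then have z: "z \<in> V" "\<And>x. x \<in> X \<Longrightarrow> E x z" "\<And>x. x \<in> S \<Longrightarrow> E x z" "\<And>x. x \<in> S \<Longrightarrow> E z x"
    using sgraph_sym[OF E] by (auto simp: common_nbrs_def)
  have "z \<notin> S" using z sgraph_irrefl[OF E] by blast
  then have "insert z S \<in> kcliques E (Suc s) (common_nbrs E V X)"
    using S z by (auto simp: kcliques_def cliques_def common_nbrs_def)
  then show ?case by blast
qed (auto simp: kcliques_0)

text \<open>Fix an \<open>(s - 1)\<close>-clique and vary only the last vertex.\<close>

lemma card_kcliques_common_nbrs_ge:
  assumes X: "X \<subseteq> V" "card X + s \<le> p" "1 \<le> s" and n: "card V \<ge> p * L + p * B" "L \<ge> 1"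
  shows "L \<le> card (kcliques E s (common_nbrs E V X))"
proof -
  obtain s' where s': "s = Suc s'" using X by (cases s) auto
  have "p * 1 \<le> p * L" using n by (intro mult_left_mono) auto
  then have n1: "card V \<ge> p + p * B" using n by linarith
  obtain S where S: "S \<in> kcliques E s' (common_nbrs E V X)"
    using clique_extension[of X s', OF X(1) _ n1] X s' by auto
  have "card (X \<union> S) + 1 \<le> p"
    using X S card_Un_le[of X S] s' by (auto simp: kcliques_def)
  moreover have "X \<union> S \<subseteq> V" using S X by (auto simp: kcliques_def cliques_def common_nbrs_def)
  ultimately have "L \<le> card (common_nbrs E V (X \<union> S))"
    by (intro card_common_nbrs_ge) (use n in auto)
  also have "\<dots> \<le> card (kcliques E s (common_nbrs E V X))"
  proof (rule card_inj_on_le)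
    have zS: "z \<notin> S" if "z \<in> common_nbrs E V (X \<union> S)" for z
      using that sgraph_irrefl[OF E] by (auto simp: common_nbrs_def)
    show "inj_on (\<lambda>z. insert z S) (common_nbrs E V (X \<union> S))"
      by (rule inj_onI) (use zS in blast)
    show "(\<lambda>z. insert z S) ` common_nbrs E V (X \<union> S) \<subseteq> kcliques E s (common_nbrs E V X)"
    proof (rule image_subsetI)
      fix z assume z: "z \<in> common_nbrs E V (X \<union> S)"
      then show "insert z S \<in> kcliques E s (common_nbrs E V X)"
        using S zS[OF z] s' sgraph_sym[OF E] by (auto simp: kcliques_def cliques_def common_nbrs_def)
    qed
    show "finite (kcliques E s (common_nbrs E V X))"
      using V by (simp add: finite_kcliques finite_common_nbrs)
  qed
  finally show ?thesis .
qed

text \<open>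
  Take a clique \<open>Y\<close> of size \<open>p\<close>. All but boundedly many vertices are nonadjacent to exactly
  one \<open>y \<in> Y\<close>; this gives classes \<open>W y\<close>, and every vertex is adjacent to almost nothing in
  one of them, which becomes its colour.
\<close>

lemma high_degree_colouring:
  assumes n: "card V \<ge> p + (2 * p - 1) * B + p * (2 * (2 * B + 2 * p * B) + 2 * p * B + 1)"
  shows "\<exists>(col :: 'a \<Rightarrow> 'a) Y. finite Y \<and> card Y = p \<and> col ` V \<subseteq> Y \<and>
    (\<forall>w\<in>V. \<forall>w'\<in>V. w \<noteq> w' \<longrightarrow> col w = col w' \<longrightarrow>
      \<not> E w w' \<and> kcliques E (p - 1) (common_nbrs E V {w, w'}) \<noteq> {})"
proof -
  note sym = sgraph_sym[OF E] and irr = sgraph_irrefl[OF E]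
  have no_clique: False if "S \<subseteq> V" "card S = Suc p" "\<And>x y. x \<in> S \<Longrightarrow> y \<in> S \<Longrightarrow> x \<noteq> y \<Longrightarrow> E x y" for S
  proof -
    have "S \<in> kcliques E (Suc p) V"
      using that V finite_subset[OF that(1)] by (auto simp: kcliques_def cliques_def)
    then show False using free by simp
  qed
  define N where "N v = {x \<in> V. \<not> E v x}" for v
  have fN: "finite (N v)" for v using V by (simp add: N_def)
  have "p * B \<le> (2 * p - 1) * B" using p by (intro mult_right_mono) auto
  then have "card V \<ge> p + p * B" using n by linarith
  then obtain Y where "Y \<in> kcliques E p (common_nbrs E V {})"
    using clique_extension[of "{}" p] by auto
  then have Y: "Y \<subseteq> V" "finite Y" "card Y = p" and YE: "\<And>x y. x \<in> Y \<Longrightarrow> y \<in> Y \<Longrightarrow> x \<noteq> y \<Longrightarrow> E x y"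
    by (auto simp: kcliques_def cliques_def common_nbrs_def)
  define W where "W y = {v \<in> V. \<forall>z\<in>Y. E v z \<longleftrightarrow> z \<noteq> y}" for y
  have fW: "finite (W y)" for y using V by (simp add: W_def)
  have WN: "W y \<subseteq> N y" if "y \<in> Y" for y using that sym by (auto simp: W_def N_def)
  have Wdisj: "W y \<inter> W y' = {}" if "y \<in> Y" "y' \<in> Y" "y \<noteq> y'" for y y'
    using that by (auto simp: W_def)
  have indep: "\<not> E u v" if y: "y \<in> Y" and uv: "u \<in> W y" "v \<in> W y" for u v y
  proof
    assume uv': "E u v"
    let ?S = "insert u (insert v (Y - {y}))"
    have "u \<noteq> v" using uv' irr by auto
    moreover have "u \<notin> Y - {y}" "v \<notin> Y - {y}" using uv irr by (auto simp: W_def)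
    ultimately have "card ?S = Suc p" using Y y p by (simp add: card_Diff_singleton)
    moreover have "?S \<subseteq> V" using uv Y by (auto simp: W_def)
    moreover have "E a b" if "a \<in> ?S" "b \<in> ?S" "a \<noteq> b" for a b
      using that uv uv' sym YE by (auto simp: W_def)
    ultimately show False using no_clique by blast
  qed
  have dN: "p * card (N v) \<le> card V + B" if "v \<in> V" for v using deg[OF that] by (simp add: N_def)
  define R where "R = V - (\<Union>y\<in>Y. W y)"
  \<comment> \<open>Each vertex misses some vertex of \<open>Y\<close>, and at least two if it lies
    in no \<open>W y\<close>. Double counting against the degree bound then gives
    \<open>card R \<le> B\<close>.\<close>
  have cnt: "1 + of_bool (v \<in> R) \<le> card {y \<in> Y. \<not> E y v}" if v: "v \<in> V" for v
  proof -
    have "{y \<in> Y. \<not> E y v} \<noteq> {}"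
    proof
      assume *: "{y \<in> Y. \<not> E y v} = {}"
      then have "v \<notin> Y" using irr by blast
      then have "card (insert v Y) = Suc p" using Y by simp
      moreover have "E a b" if "a \<in> insert v Y" "b \<in> insert v Y" "a \<noteq> b" for a b
        using that * YE sym by blast
      ultimately show False using no_clique[of "insert v Y"] Y v by blast
    qed
    then have 1: "card {y \<in> Y. \<not> E y v} \<ge> 1" using Y by (simp add: Suc_leI card_gt_0_iff)
    have "card {y \<in> Y. \<not> E y v} \<noteq> 1" if "v \<in> R"
    proof
      assume "card {y \<in> Y. \<not> E y v} = 1"
      then obtain y where "{y \<in> Y. \<not> E y v} = {y}" by (auto simp: card_1_singleton_iff)
      then have "y \<in> Y" "\<And>z. z \<in> Y \<Longrightarrow> E v z \<longleftrightarrow> z \<noteq> y" using sym by blast+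
      then have "v \<in> W y" using v by (auto simp: W_def)
      then show False using that \<open>y \<in> Y\<close> by (auto simp: R_def)
    qed
    then show ?thesis using 1 by fastforce
  qed
  have "card V + card R = (\<Sum>v\<in>V. 1 + of_bool (v \<in> R))"
  proof -
    have "V \<inter> R = R" by (auto simp: R_def)
    then have "(\<Sum>v\<in>V. of_bool (v \<in> R)) = card R"
      using V by (simp add: of_bool_def sum.If_cases)
    then show ?thesis by (simp only: sum.distrib) simp
  qed
  also have "\<dots> \<le> (\<Sum>v\<in>V. card {y \<in> Y. \<not> E y v})" by (rule sum_mono) (rule cnt)
  also have "\<dots> = (\<Sum>y\<in>Y. card (N y))"
    unfolding N_def using sum_multicount_gen[of Y V "\<lambda>y v. \<not> E y v" "\<lambda>v. card {y \<in> Y. \<not> E y v}"] V Y by simp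
  finally have "p * (card V + card R) \<le> (\<Sum>y\<in>Y. p * card (N y))"
    by (simp flip: sum_distrib_left)
  also have "\<dots> \<le> p * (card V + B)"
    using sum_bounded_above[of Y "\<lambda>y. p * card (N y)" "card V + B"] dN Y by auto
  finally have R: "card R \<le> B" using p by simp
  \<comment> \<open>The other \<open>p - 1\<close> classes have at most
    \<open>(card V + B) / p\<close> vertices each, so \<open>W y\<close> receives its share up to a
    constant.\<close>
  have bigW: "card V \<le> (2 * p - 1) * B + p * card (W y)" if y: "y \<in> Y" for y
  proof -
    have "V \<subseteq> R \<union> (\<Union>z\<in>Y. W z)" by (auto simp: R_def)
    then have "card V \<le> card (R \<union> (\<Union>z\<in>Y. W z))" using V Y fW by (intro card_mono) (auto simp: R_def)
    also have "\<dots> \<le> card R + (\<Sum>z\<in>Y. card (W z))"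
      by (rule order_trans[OF card_Un_le]) (simp add: card_UN_le Y)
    also have "\<dots> = card R + (card (W y) + (\<Sum>z\<in>Y - {y}. card (W z)))"
      using Y y by (simp add: sum.remove)
    also have "\<dots> \<le> B + (card (W y) + (\<Sum>z\<in>Y - {y}. card (N z)))"
      using R WN fN fW by (intro add_mono sum_mono card_mono) auto
    finally have "p * card V \<le> p * (B + (card (W y) + (\<Sum>z\<in>Y - {y}. card (N z))))"
      by (rule mult_le_mono2)
    also have "\<dots> = p * B + p * card (W y) + (\<Sum>z\<in>Y - {y}. p * card (N z))"
      by (simp only: distrib_left sum_distrib_left add.assoc)
    also have "(\<Sum>z\<in>Y - {y}. p * card (N z)) \<le> card (Y - {y}) * (card V + B)"
      using sum_bounded_above[of "Y - {y}" "\<lambda>z. p * card (N z)" "card V + B"] dN Y by auto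
    also have "card (Y - {y}) = p - 1" using Y y by (simp add: card_Diff_singleton)
    finally show ?thesis using p by (cases p) (auto simp: algebra_simps)
  qed
  have Nle: "card (N v) \<le> card (W y) + 2 * B" if v: "v \<in> V" and y: "y \<in> Y" for v y
  proof -
    have "p * card (N v) \<le> (2 * p - 1) * B + p * card (W y) + B" using dN[OF v] bigW[OF y] by linarith
    also have "(2 * p - 1) * B + p * card (W y) + B = p * (card (W y) + 2 * B)"
      using p by (cases p) (auto simp: algebra_simps)
    finally show ?thesis using p by simp
  qed
  have miss: "card (N v - W y) \<le> 2 * B" if v: "v \<in> W y" and y: "y \<in> Y" for v y
  proof -
    have "W y \<subseteq> N v" using indep[OF y v] by (auto simp: N_def W_def)
    then have "card (N v - W y) = card (N v) - card (W y)" using fW by (simp add: card_Diff_subset)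
    moreover have "v \<in> V" using v by (simp add: W_def)
    ultimately show ?thesis using Nle[of v y] y by simp
  qed
  have greedy: "\<exists>S\<in>cliques E (\<Union>y\<in>J. U y). card S = card J"
    if J: "J \<subseteq> Y" and U: "\<And>y. y \<in> J \<Longrightarrow> U y \<subseteq> W y \<and> card J * (2 * B) < card (U y)" for J U
  proof (rule greedy_transversal[OF _ _ _ E])
    show "finite J" using J Y finite_subset by blast
    show "finite (U y) \<and> card J * (2 * B) < card (U y)" if "y \<in> J" for y
      using U[OF that] fW finite_subset by blast
    fix y y' z assume *: "y \<in> J" "y' \<in> J" "y \<noteq> y'" "z \<in> U y"
    then have "{x \<in> U y'. \<not> E z x} \<subseteq> N z - W y"
      using U[of y'] Wdisj[of y y'] J by (auto simp: N_def W_def)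
    then have "card {x \<in> U y'. \<not> E z x} \<le> card (N z - W y)" by (intro card_mono) (simp add: fN)
    also have "\<dots> \<le> 2 * B" using miss * U J by blast
    finally show "card {x \<in> U y'. \<not> E z x} \<le> 2 * B" .
  qed
  \<comment> \<open>Otherwise the greedy choice finds a \<open>p\<close>-clique inside the
    neighbourhood of \<open>w\<close>.\<close>
  have "\<exists>y\<in>Y. card {x \<in> W y. E w x} \<le> p * (2 * B)" if w: "w \<in> V" for w
  proof (rule ccontr)
    assume "\<not> (\<exists>y\<in>Y. card {x \<in> W y. E w x} \<le> p * (2 * B))"
    then have "\<exists>S\<in>cliques E (\<Union>y\<in>Y. {x \<in> W y. E w x}). card S = card Y"
      by (intro greedy) (auto simp: Y not_le)
    then obtain S where S: "S \<in> cliques E (\<Union>y\<in>Y. {x \<in> W y. E w x})" "card S = p" using Y by auto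
    have wS: "E w x" if "x \<in> S" for x using S that by (auto simp: cliques_def)
    then have "w \<notin> S" using irr by blast
    then have "card (insert w S) = Suc p" using S by (simp add: cliques_def)
    moreover have "insert w S \<subseteq> V" using w S by (auto simp: cliques_def W_def)
    moreover have "E a b" if "a \<in> insert w S" "b \<in> insert w S" "a \<noteq> b" for a b
      using that S wS sym by (auto simp: cliques_def)
    ultimately show False using no_clique by blast
  qed
  then obtain col where col: "\<And>w. w \<in> V \<Longrightarrow> col w \<in> Y \<and> card {x \<in> W (col w). E w x} \<le> p * (2 * B)"
    by metis
  \<comment> \<open>Missing nearly all of its own class already uses up almost all nonneighbours
    that \<open>w\<close> may have.\<close>
  have out: "card (N w - W (col w)) \<le> 2 * B + 2 * p * B" if w: "w \<in> V" for w
  proof -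
    let ?y = "col w"
    have "card (W ?y) = card {x \<in> W ?y. E w x} + card (N w \<inter> W ?y)"
    proof -
      have "W ?y = {x \<in> W ?y. E w x} \<union> (N w \<inter> W ?y)" "{x \<in> W ?y. E w x} \<inter> (N w \<inter> W ?y) = {}"
        by (auto simp: N_def W_def)
      then show ?thesis using fW by (metis (no_types, lifting) card_Un_disjoint finite_Un)
    qed
    moreover have "card (N w) = card (N w \<inter> W ?y) + card (N w - W ?y)"
      using fN by (metis card_Int_Diff)
    ultimately show ?thesis using Nle[OF w, of ?y] col[OF w] by (simp add: algebra_simps)
  qed
  \<comment> \<open>Vertices of one colour have many common neighbours in each of the other
    \<open>p - 1\<close> classes. A transversal clique there is the witness, and an edge
    \<open>w w'\<close> would extend it to a \<open>(p + 1)\<close>-clique.\<close>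
  have "\<not> E w w' \<and> kcliques E (p - 1) (common_nbrs E V {w, w'}) \<noteq> {}"
    if w: "w \<in> V" "w' \<in> V" "w \<noteq> w'" "col w = col w'" for w w'
  proof -
    define U where "U z = {x \<in> W z. E w x \<and> E w' x}" for z
    have cJ: "card (Y - {col w}) = p - 1" using Y col[OF w(1)] by (simp add: card_Diff_singleton)
    have "card (Y - {col w}) * (2 * B) < card (U z)" if z: "z \<in> Y - {col w}" for z
    proof -
      have "W z \<subseteq> U z \<union> ((N w - W (col w)) \<union> (N w' - W (col w)))"
        using Wdisj[of z "col w"] z col[OF w(1)] by (auto simp: U_def N_def W_def)
      then have "card (W z) \<le> card (U z \<union> ((N w - W (col w)) \<union> (N w' - W (col w))))"
        using fW fN by (intro card_mono) (auto simp: U_def)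
      also have "\<dots> \<le> card (U z) + (card (N w - W (col w)) + card (N w' - W (col w)))"
        by (meson card_Un_le add_left_mono order_trans)
      also have "\<dots> \<le> card (U z) + 2 * (2 * B + 2 * p * B)" using out[OF w(1)] out[OF w(2)] w(4) by simp
      finally have 1: "card (W z) \<le> card (U z) + 2 * (2 * B + 2 * p * B)" .
      have "p * (2 * (2 * B + 2 * p * B) + 2 * p * B + 1) \<le> p * card (W z)"
        using n bigW[OF DiffD1[OF z]] by linarith
      then have "2 * (2 * B + 2 * p * B) + 2 * p * B + 1 \<le> card (W z)"
        using p by (simp only: mult_le_cancel1)
      then have "2 * p * B < card (U z)" using 1 by linarith
      moreover have "(p - 1) * (2 * B) \<le> p * (2 * B)" by (intro mult_right_mono) auto
      ultimately show ?thesis using cJ by (simp add: algebra_simps)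
    qed
    then have "\<exists>S\<in>cliques E (\<Union>y\<in>Y - {col w}. U y). card S = card (Y - {col w})"
      by (intro greedy) (auto simp: U_def)
    then obtain S where S: "S \<in> cliques E (\<Union>y\<in>Y - {col w}. U y)" "card S = p - 1" using cJ by auto
    have wS: "E w x" "E w' x" if "x \<in> S" for x using S that by (auto simp: cliques_def U_def)
    have SV: "S \<subseteq> V" "finite S" using S by (auto simp: cliques_def U_def W_def)
    have "S \<in> kcliques E (p - 1) (common_nbrs E V {w, w'})"
      using S wS SV by (auto simp: kcliques_def cliques_def common_nbrs_def)
    moreover have "\<not> E w w'"
    proof
      assume ww: "E w w'"
      have "w \<notin> S" "w' \<notin> S" using wS irr by blast+
      then have "card (insert w (insert w' S)) = Suc p" using S SV w p by simp
      moreover have "E a b" if "a \<in> insert w (insert w' S)" "b \<in> insert w (insert w' S)" "a \<noteq> b" for a b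
        using that S wS sym ww by (auto simp: cliques_def)
      ultimately show False using no_clique[of "insert w (insert w' S)"] SV w by blast
    qed
    ultimately show ?thesis by blast
  qed
  then show ?thesis using Y col by (intro exI[of _ col] exI[of _ Y]) blast
qed

end

text \<open>
  Adding all addable pairs at once keeps the graph free of \<open>(p + 1)\<close>-cliques, and each added pair
  creates at least \<open>c + D\<close> new \<open>r\<close>-cliques, which pays for its contribution to the score.
\<close>

lemma high_degree_score:
  assumes E: "sgraph E" and V: "finite V" and free: "kcliques E (Suc p) V = {}"
    and deg: "\<And>v. v \<in> V \<Longrightarrow> p * card {x \<in> V. \<not> E v x} \<le> card V + B"
    and r: "3 \<le> r" "r \<le> p"
    and n1: "card V \<ge> p + (2 * p - 1) * B + p * (2 * (2 * B + 2 * p * B) + 2 * p * B + 1)"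
    and n2: "card V \<ge> p * (c + D + 1) + p * B"
    and n3: "(c + 1) * tau 2 (card V) p \<le> tau r (card V) p"
  shows "score r c D (p - 1) E V + c * tau 2 (card V) p \<le> tau r (card V) p + c * (card V choose 2)"
proof -
  note sym = sgraph_sym[OF E] and irr = sgraph_irrefl[OF E]
  have p: "p \<ge> 1" using r by simp
  define M where "M = addable (p - 1) E V"
  define F where "F x y \<longleftrightarrow> E x y \<or> {x, y} \<in> M" for x y
  have fM: "finite M" using V by (simp add: M_def finite_addable)
  have M2: "M \<subseteq> [V]\<^bsup>2\<^esup>" by (auto simp: M_def addable_def nonedges_def)
  have ME: "\<not> E x y" if "{x, y} \<in> M" for x y
  proof
    assume "E x y"
    moreover have "x \<in> V" "y \<in> V" using M2 that by auto
    ultimately have "{x, y} \<in> cliques E V" using sym by (auto simp: cliques_def)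
    then show False using that by (auto simp: M_def addable_def nonedges_def)
  qed
  have F: "sgraph F"
    using sym irr ME M2 by (intro sgraphI) (auto simp: F_def insert_commute nsets_def)
  obtain col :: "'a \<Rightarrow> 'a" and Y where Y: "finite Y" "card Y = p" "col ` V \<subseteq> Y"
    and col: "\<And>w w'. w \<in> V \<Longrightarrow> w' \<in> V \<Longrightarrow> w \<noteq> w' \<Longrightarrow> col w = col w' \<Longrightarrow>
      \<not> E w w' \<and> kcliques E (p - 1) (common_nbrs E V {w, w'}) \<noteq> {}"
    using high_degree_colouring[OF E V free deg p n1] by metis
  \<comment> \<open>Pairs of equal colour are neither edges nor addable, so \<open>col\<close>
    properly colours \<open>F\<close> with \<open>p\<close> colours.\<close>
  have free': "kcliques F (Suc p) V = {}"
  proof (rule equals0I)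
    fix S assume S: "S \<in> kcliques F (Suc p) V"
    have "inj_on col S"
    proof (rule inj_onI, rule ccontr)
      fix x y assume *: "x \<in> S" "y \<in> S" "col x = col y" "x \<noteq> y"
      then have "x \<in> V" "y \<in> V" "F x y" using S by (auto simp: kcliques_def cliques_def)
      then show False using col[of x y] * by (auto simp: F_def M_def addable_def)
    qed
    moreover have "col ` S \<subseteq> Y" using S Y by (auto simp: kcliques_def cliques_def)
    ultimately have "card S \<le> p" using Y by (metis card_inj_on_le)
    then show False using S by (simp add: kcliques_def)
  qed
  have "nonedges E V = nonedges F V \<union> M" "nonedges F V \<inter> M = {}"
  proof -
    have *: "e \<in> cliques F V \<longleftrightarrow> e \<in> cliques E V \<or> e \<in> M" if eV: "e \<in> [V]\<^bsup>2\<^esup>" for e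
    proof -
      obtain x y where e: "e = {x, y}" "x \<in> V" "y \<in> V" "x \<noteq> y" using eV by (auto elim: nsets2_E)
      have "e \<in> cliques F V \<longleftrightarrow> F x y" using e sgraph_sym[OF F] by (auto simp: cliques_def)
      moreover have "e \<in> cliques E V \<longleftrightarrow> E x y" using e sym by (auto simp: cliques_def)
      ultimately show ?thesis using e by (simp add: F_def)
    qed
    show "nonedges E V = nonedges F V \<union> M"
      using * M2 by (auto simp: nonedges_def M_def addable_def)
    show "nonedges F V \<inter> M = {}" using * M2 by (auto simp: nonedges_def)
  qed
  then have ne: "card (nonedges E V) = card (nonedges F V) + card M"
    using V fM by (simp add: card_Un_disjoint finite_nonedges)
  define K where "K e = kcliques E (r - 2) (common_nbrs E V e)" for e
  have cK: "c + D \<le> card (K e)" if e: "e \<in> M" for e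
  proof -
    have "e \<subseteq> V" "card e = 2" using e M2 by (auto simp: nsets_def)
    then have "c + D + 1 \<le> card (K e)" unfolding K_def
      using r p n2 by (intro card_kcliques_common_nbrs_ge[OF E V free deg p]) auto
    then show ?thesis by simp
  qed
  have K: "S \<in> kcliques E (r - 2) V \<and> S \<inter> e = {} \<and> (\<forall>x\<in>e. \<forall>y\<in>S. E x y \<and> E y x)" if "S \<in> K e" for S e
  proof -
    have *: "E x y" if "x \<in> e" "y \<in> S" for x y
      using that \<open>S \<in> K e\<close> by (auto simp: K_def kcliques_def cliques_def common_nbrs_def)
    then have "S \<inter> e = {}" using irr by blast
    with * sym that show ?thesis by (auto simp: K_def kcliques_def cliques_def common_nbrs_def)
  qed
  \<comment> \<open>All pairs inside \<open>e \<union> S\<close> other than \<open>e\<close> are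
    edges of \<open>E\<close>, so a new clique determines the pair of \<open>M\<close> it comes
    from.\<close>
  have sep: "e' = e" if e: "e \<in> M" "e' \<in> M" and S: "S \<in> K e" and sub: "e' \<subseteq> e \<union> S" for e e' S
  proof -
    obtain x y where xy: "e' = {x, y}" "x \<noteq> y" using subsetD[OF M2 e(2)] by (auto elim: nsets2_E)
    have n: "\<not> E x y" using ME e xy by simp
    have "x \<notin> S" "y \<notin> S" using K[OF S] sub xy n by (auto simp: kcliques_def cliques_def)
    then have "e' \<subseteq> e" using sub xy by auto
    moreover have "finite e" "card e = 2" "card e' = 2" using e M2 by (auto simp: nsets_def)
    ultimately show ?thesis by (simp add: card_subset_eq)
  qed
  let ?f = "\<lambda>(e, S). e \<union> S"
  have inj: "inj_on ?f (Sigma M K)"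
  proof (rule inj_onI, clarify)
    fix e S e' S' assume *: "e \<in> M" "S \<in> K e" "e' \<in> M" "S' \<in> K e'" "e \<union> S = e' \<union> S'"
    then have "e' = e" using sep[of e e' S] by blast
    moreover have "S = (e \<union> S) - e" "S' = (e' \<union> S') - e'" using K *(2,4) by blast+
    ultimately show "e = e' \<and> S = S'" using * by metis
  qed
  have img: "?f ` Sigma M K \<subseteq> kcliques F r V - kcliques E r V"
  proof clarify
    fix e S assume *: "e \<in> M" "S \<in> K e"
    obtain x y where xy: "e = {x, y}" "x \<in> V" "y \<in> V" "x \<noteq> y" using subsetD[OF M2 *(1)] by (auto elim: nsets2_E)
    have S: "S \<subseteq> V" "finite S" "card S = r - 2" "S \<inter> e = {}" "\<And>a b. a \<in> S \<Longrightarrow> b \<in> S \<Longrightarrow> a \<noteq> b \<Longrightarrow> E a b"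
      "\<And>a b. a \<in> e \<Longrightarrow> b \<in> S \<Longrightarrow> E a b \<and> E b a"
      using K[OF *(2)] by (auto simp: kcliques_def cliques_def)
    have "card (e \<union> S) = card e + card S" using S xy by (intro card_Un_disjoint) auto
    then have "card (e \<union> S) = r" using S xy r by simp
    moreover have "F a b" if "a \<in> e \<union> S" "b \<in> e \<union> S" "a \<noteq> b" for a b
      using that S *(1) unfolding F_def xy(1) by (auto simp: insert_commute)
    moreover have "\<not> E x y" using ME * xy by simp
    ultimately show "e \<union> S \<in> kcliques F r V - kcliques E r V"
      using S xy by (auto simp: kcliques_def cliques_def)
  qed
  have "card M * (c + D) \<le> (\<Sum>e\<in>M. card (K e))"
    using sum_bounded_below[of M "c + D" "\<lambda>e. card (K e)"] cK by simp
  also have "\<dots> = card (Sigma M K)" using fM V by (simp add: K_def finite_kcliques finite_common_nbrs)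
  also have "\<dots> = card (?f ` Sigma M K)" by (rule card_image[OF inj, symmetric])
  also have "\<dots> \<le> card (kcliques F r V - kcliques E r V)"
    using V by (intro card_mono[OF _ img]) (simp add: finite_kcliques)
  finally have "card M * (c + D) + card (kcliques E r V) \<le>
      card (kcliques F r V - kcliques E r V) + card (kcliques E r V)" by simp
  also have "\<dots> = card (kcliques F r V)"
  proof -
    have "kcliques E r V \<subseteq> kcliques F r V" by (auto simp: kcliques_def cliques_def F_def)
    then show ?thesis using V by (simp add: card_Diff_subset card_mono finite_kcliques)
  qed
  \<comment> \<open>A pair of \<open>M\<close> counts \<open>c + D\<close> in the score of
    \<open>E\<close>, as nonedge and as addable pair; the new \<open>r\<close>-cliques pay for
    this.\<close>
  finally have "score r c D (p - 1) E V \<le> card (kcliques F r V) + c * card (nonedges F V)"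
    unfolding score_def M_def[symmetric] ne by (simp add: algebra_simps)
  moreover have "card (kcliques F r V) + c * tau 2 (card V) p \<le> tau r (card V) p + c * card (kcliques F 2 V)"
    using zykov_card_kcliques_penalized[OF F V free' _ n3] r by simp
  moreover have "c * card (nonedges F V) + c * card (kcliques F 2 V) = c * (card V choose 2)"
    using card_nonedges[OF V, of F] by (metis add_mult_distrib2)
  ultimately show ?thesis by linarith
qed

section \<open>Progressive induction\<close>

text \<open>Every nonedge or addable pair that disappears contains \<open>v\<close>: deleting
  \<open>v\<close> only shrinks common neighbourhoods, so other addable pairs stay addable.\<close>

lemma score_remove_le:
  assumes E: "sgraph E" and V: "finite V" "v \<in> V" and r: "r \<ge> 1"
  shows "score r c D q E V \<le>
    score r c D q E (V - {v}) + card (kcliques E (r - 1) (nbrs E V v)) + (c + D) * (card V - 1)"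
proof -
  let ?star = "(\<lambda>x. {v, x}) ` (V - {v})"
  have cstar: "card ?star \<le> card V - 1"
    using card_image_le[of "V - {v}" "\<lambda>x. {v, x}"] V by (simp add: card_Diff_singleton)
  have sub: "nonedges E V \<subseteq> nonedges E (V - {v}) \<union> ?star"
  proof
    fix e assume e: "e \<in> nonedges E V"
    then obtain x y where xy: "e = {x, y}" "x \<in> V" "y \<in> V" "x \<noteq> y"
      unfolding nonedges_def by (auto elim: nsets2_E)
    show "e \<in> nonedges E (V - {v}) \<union> ?star"
      using e xy V by (cases "v = x \<or> v = y") (auto simp: nonedges_def cliques_def)
  qed
  have "addable q E V \<subseteq> addable q E (V - {v}) \<union> ?star"
  proof
    fix e assume e: "e \<in> addable q E V"
    have "kcliques E q (common_nbrs E (V - {v}) e) \<subseteq> kcliques E q (common_nbrs E V e)"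
      by (rule kcliques_mono) (auto simp: common_nbrs_def)
    then show "e \<in> addable q E (V - {v}) \<union> ?star" using e sub by (auto simp: addable_def)
  qed
  then have "card (addable q E V) \<le> card (addable q E (V - {v}) \<union> ?star)"
    using V by (intro card_mono) (auto simp: finite_addable)
  then have 1: "card (addable q E V) \<le> card (addable q E (V - {v})) + (card V - 1)"
    using card_Un_le[of "addable q E (V - {v})" ?star] cstar by linarith
  have "card (nonedges E V) \<le> card (nonedges E (V - {v}) \<union> ?star)"
    using V by (intro card_mono sub) (auto simp: finite_nonedges)
  then have 2: "card (nonedges E V) \<le> card (nonedges E (V - {v})) + (card V - 1)"
    using card_Un_le[of "nonedges E (V - {v})" ?star] cstar by linarith
  have 3: "card (kcliques E r V) = card (kcliques E r (V - {v})) + card (kcliques E (r - 1) (nbrs E V v))"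
    using card_kcliques_remove[OF E V(2,1), of "r - 1"] r by simp
  show ?thesis
    unfolding score_def 3 using mult_le_mono2[OF 1, of D] mult_le_mono2[OF 2, of c]
    unfolding distrib_left distrib_right by linarith
qed

lemma score_le_crude:
  assumes V: "finite V"
  shows "score r c D q E V \<le> 2 ^ card V * (1 + c + D)"
proof -
  have *: "card A \<le> 2 ^ card V" if "A \<subseteq> Pow V" for A
    using card_mono[OF _ that] V by (simp add: card_Pow)
  have "card (kcliques E r V) \<le> 2 ^ card V" by (rule *) (auto simp: kcliques_def cliques_def)
  moreover have "card (nonedges E V) \<le> 2 ^ card V" by (rule *) (auto simp: nonedges_def nsets_def)
  moreover have "card (addable q E V) \<le> 2 ^ card V"
    by (rule *) (auto simp: addable_def nonedges_def nsets_def)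
  ultimately have "score r c D q E V \<le> 2 ^ card V + c * 2 ^ card V + D * 2 ^ card V"
    unfolding score_def by (intro add_mono mult_le_mono2) auto
  then show ?thesis by (simp add: algebra_simps)
qed

text \<open>
  Either every vertex has so many \<open>r\<close>-cliques through it that its degree is extremal up to a
  constant, or some vertex can be deleted at a loss smaller than that of the extremal graph.
\<close>

lemma score_step:
  assumes r: "3 \<le> r" "r \<le> p"
  shows "\<exists>N. \<forall>n\<ge>N. \<forall>(E :: 'a \<Rightarrow> 'a \<Rightarrow> bool) V.
    sgraph E \<longrightarrow> finite V \<longrightarrow> kcliques E (Suc p) V = {} \<longrightarrow> card V = Suc n \<longrightarrow>
    score r c D (p - 1) E V + c * tau 2 (Suc n) p \<le> tau r (Suc n) p + c * (Suc n choose 2) \<or>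
    (\<exists>v\<in>V. score r c D (p - 1) E V + c * tau 2 (Suc n) p + (tau r n p + c * (n choose 2)) + 1
      \<le> score r c D (p - 1) E (V - {v}) + c * tau 2 n p + (tau r (Suc n) p + c * (Suc n choose 2)))"
proof -
  obtain q where q: "p = Suc q" using r by (cases p) auto
  obtain m where m: "r = Suc m" using r by (cases r) auto
  have mq: "2 \<le> m" "m \<le> q" using r q m by auto
  obtain C N1 where drop: "\<And>n x d. n \<ge> N1 \<Longrightarrow> n \<le> 2 * x \<Longrightarrow>
      tau m x q \<le> tau m d q + (c + D) * n \<Longrightarrow> x \<le> d + C"
    using tau_drop[OF mq, of "c + D"] unfolding eventually_sequentially by blast
  obtain N2 where dom: "\<And>n. n \<ge> N2 \<Longrightarrow> (c + 1) * tau 2 n p \<le> tau r n p"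
    using eventually_tau_dominates[OF r, of "c + 1"] unfolding eventually_sequentially by blast
  \<comment> \<open>If \<open>v\<close> has at least \<open>n - n div p - C\<close> neighbours among
    \<open>Suc n\<close> vertices, it has at most \<open>n div p + C + 1\<close> nonneighbours,
    itself included; \<open>B\<close> results on multiplying by \<open>p\<close>.\<close>
  define B where "B = p * (C + 1)"
  define N3 where "N3 = p + (2 * p - 1) * B + p * (2 * (2 * B + 2 * p * B) + 2 * p * B + 1)"
  define N4 where "N4 = p * (c + D + 1) + p * B"
  have "score r c D (p - 1) E V + c * tau 2 (Suc n) p \<le> tau r (Suc n) p + c * (Suc n choose 2)"
    if n: "n \<ge> N1 + N2 + N3 + N4" and E: "sgraph E" and V: "finite V" and free: "kcliques E (Suc p) V = {}"
      and cV: "card V = Suc n"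
      and no: "\<not> (\<exists>v\<in>V. score r c D (p - 1) E V + c * tau 2 (Suc n) p + (tau r n p + c * (n choose 2)) + 1
        \<le> score r c D (p - 1) E (V - {v}) + c * tau 2 n p + (tau r (Suc n) p + c * (Suc n choose 2)))"
    for n and E :: "'a \<Rightarrow> 'a \<Rightarrow> bool" and V
  proof -
    define x where "x = n - n div p"
    have tr: "tau r (Suc n) p = tau r n p + tau m x q" by (simp add: m q x_def)
    have t2: "tau 2 (Suc n) p = tau 2 n p + x" by (simp add: numeral_2_eq_2 tau_Suc_0 x_def)
    have ch: "Suc n choose 2 = (n choose 2) + n" by (simp add: numeral_2_eq_2)
    have deg: "p * card {y \<in> V. \<not> E v y} \<le> card V + B" if v: "v \<in> V" for v
    proof -
      define d where "d = card (nbrs E V v)"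
      have free': "kcliques E (Suc q) (nbrs E V v) = {}"
      proof (rule equals0I)
        fix S assume S: "S \<in> kcliques E (Suc q) (nbrs E V v)"
        have vS: "E v y" "E y v" if "y \<in> S" for y
          using that S sgraph_sym[OF E] by (auto simp: kcliques_def cliques_def nbrs_def)
        have "v \<notin> S" using vS sgraph_irrefl[OF E] by blast
        then have "insert v S \<in> kcliques E (Suc p) V"
          using S v vS by (auto simp: kcliques_def cliques_def nbrs_def q)
        then show False using free by simp
      qed
      have 1: "card (kcliques E m (nbrs E V v)) \<le> tau m d q"
        unfolding d_def using mq by (intro zykov_card_kcliques E free' finite_nbrs V) auto
      \<comment> \<open>Since the deletion alternative fails, removing \<open>v\<close> loses at
        least as much as in the extremal graph. So the neighbourhood of \<open>v\<close> has nearly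
        the extremal number of \<open>m\<close>-cliques, up to an error linear in
        \<open>n\<close>.\<close>
      have "score r c D (p - 1) E (V - {v}) + tau m x q + c * n \<le> score r c D (p - 1) E V + c * x"
        using no v unfolding tr t2 ch by (auto simp: algebra_simps not_le)
      also have "\<dots> \<le> score r c D (p - 1) E (V - {v}) + card (kcliques E m (nbrs E V v))
          + (c + D) * n + c * x"
        using score_remove_le[OF E V v, of r c D "p - 1"] r m cV by simp
      finally have "tau m x q + c * n \<le> tau m d q + (c + D) * n + c * x" using 1 by simp
      moreover have "c * x \<le> c * n" by (simp add: x_def)
      ultimately have *: "tau m x q \<le> tau m d q + (c + D) * n" by linarith
      have "n \<ge> N1" "n \<le> 2 * x" using diff_div_ge[of p n] r n by (simp_all add: x_def)
      then have xd: "x \<le> d + C" using * by (rule drop)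
      have "{y \<in> V. \<not> E v y} = V - nbrs E V v" by (auto simp: nbrs_def)
      moreover have "nbrs E V v \<subseteq> V" by (auto simp: nbrs_def)
      ultimately have "card {y \<in> V. \<not> E v y} = Suc n - d"
        using V cV by (simp add: card_Diff_subset finite_nbrs d_def)
      also have "\<dots> \<le> n div p + (C + 1)" using xd unfolding x_def by linarith
      finally have "p * card {y \<in> V. \<not> E v y} \<le> p * (n div p + (C + 1))" by (rule mult_le_mono2)
      also have "\<dots> = n div p * p + B" by (simp add: B_def distrib_left mult.commute)
      also have "\<dots> \<le> n + B" by (simp add: div_times_less_eq_dividend)
      finally show ?thesis using cV by simp
    qed
    show ?thesis
      using high_degree_score[OF E V free deg r, of c D] n cV dom[of "Suc n"]
      unfolding N3_def N4_def by simp
  qed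
  then show ?thesis by blast
qed

text \<open>Call the left side minus the right side the excess. While it is positive,
  \<open>score_step\<close> deletes a vertex and raises it by at least 1; since it is bounded at
  \<open>N\<close> vertices, it cannot be positive for large graphs.\<close>

lemma score_bound:
  assumes r: "3 \<le> r" "r \<le> p"
  shows "\<exists>N. \<forall>(E :: 'a \<Rightarrow> 'a \<Rightarrow> bool) V.
    sgraph E \<longrightarrow> finite V \<longrightarrow> kcliques E (Suc p) V = {} \<longrightarrow> N \<le> card V \<longrightarrow>
    score r c D (p - 1) E V + c * tau 2 (card V) p \<le> tau r (card V) p + c * (card V choose 2)"
proof -
  obtain N where N: "\<And>n (E :: 'a \<Rightarrow> 'a \<Rightarrow> bool) V. n \<ge> N \<Longrightarrow>
    sgraph E \<Longrightarrow> finite V \<Longrightarrow> kcliques E (Suc p) V = {} \<Longrightarrow> card V = Suc n \<Longrightarrow>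
    score r c D (p - 1) E V + c * tau 2 (Suc n) p \<le> tau r (Suc n) p + c * (Suc n choose 2) \<or>
    (\<exists>v\<in>V. score r c D (p - 1) E V + c * tau 2 (Suc n) p + (tau r n p + c * (n choose 2)) + 1
      \<le> score r c D (p - 1) E (V - {v}) + c * tau 2 n p + (tau r (Suc n) p + c * (Suc n choose 2)))"
    using score_step[OF r, of c D] by blast
  \<comment> \<open>By \<open>score_le_crude\<close>, \<open>M - N\<close> bounds the excess at
    \<open>N\<close> vertices. The invariant is that the excess is nonpositive or at most
    \<open>M - n\<close>.\<close>
  define M where "M = 2 ^ N * (1 + c + D) + c * tau 2 N p + N"
  have *: "score r c D (p - 1) E V + c * tau 2 n p \<le> tau r n p + c * (n choose 2) \<or>
    score r c D (p - 1) E V + c * tau 2 n p + n \<le> tau r n p + c * (n choose 2) + M"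
    if "N \<le> n" "sgraph E" "finite V" "kcliques E (Suc p) V = {}" "card V = n"
    for n and E :: "'a \<Rightarrow> 'a \<Rightarrow> bool" and V
    using that
  proof (induction n arbitrary: V rule: dec_induct)
    case base
    then show ?case using score_le_crude[of V r c D "p - 1" E] by (auto simp: M_def)
  next
    case (step n)
    show ?case
    proof (cases "score r c D (p - 1) E V + c * tau 2 (Suc n) p \<le> tau r (Suc n) p + c * (Suc n choose 2)")
      case False
      then obtain v where v: "v \<in> V"
        "score r c D (p - 1) E V + c * tau 2 (Suc n) p + (tau r n p + c * (n choose 2)) + 1
        \<le> score r c D (p - 1) E (V - {v}) + c * tau 2 n p + (tau r (Suc n) p + c * (Suc n choose 2))"
        using N[OF step.hyps(1) step.prems] by blast
      have "kcliques E (Suc p) (V - {v}) = {}"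
        using kcliques_mono[of "V - {v}" V E "Suc p"] step.prems by auto
      moreover have "card (V - {v}) = n" using step.prems v by (simp add: card_Diff_singleton)
      ultimately show ?thesis
        using step.IH[of "V - {v}"] step.prems v(2) False by auto
    qed simp
  qed
  have "score r c D (p - 1) E V + c * tau 2 (card V) p \<le> tau r (card V) p + c * (card V choose 2)"
    if "N + M \<le> card V" "sgraph E" "finite V" "kcliques E (Suc p) V = {}"
    for E :: "'a \<Rightarrow> 'a \<Rightarrow> bool" and V
    using *[of "card V" E V] that by auto
  then show ?thesis by blast
qed

section \<open>Heavy pairs in hypergraphs\<close>

definition codeg_edges :: "'a hypergraph \<Rightarrow> 'a set \<Rightarrow> 'a set set" where
  "codeg_edges H e = {A \<in> hedges H. e \<subseteq> A}"

text \<open>Greedy choice: \<open>Z\<close> holds what is already used, and each index handled moves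
  \<open>t\<close> elements from the reserve into \<open>Z\<close>.\<close>

lemma disjoint_subsets_avoiding:
  assumes "finite I" "finite Z" "\<And>e. e \<in> I \<Longrightarrow> finite (X e) \<and> card Z + t * card I \<le> card (X e)"
  shows "\<exists>h. (\<forall>e\<in>I. h e \<in> [X e - Z]\<^bsup>t\<^esup>) \<and> disjoint_family_on h I"
  using assms
proof (induction I arbitrary: Z rule: finite_induct)
  case (insert e I)
  have "t \<le> card (X e - Z)"
    using insert.prems(2)[of e] diff_card_le_card_Diff[OF insert.prems(1), of "X e"] insert.hyps by auto
  then obtain Y where Y: "Y \<subseteq> X e - Z" "card Y = t" "finite Y"
    by (rule obtain_subset_with_card_n)
  have "\<exists>h. (\<forall>e'\<in>I. h e' \<in> [X e' - (Z \<union> Y)]\<^bsup>t\<^esup>) \<and> disjoint_family_on h I"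
  proof (rule insert.IH)
    show "finite (X e') \<and> card (Z \<union> Y) + t * card I \<le> card (X e')" if "e' \<in> I" for e'
      using insert.prems(2)[of e'] that insert.hyps card_Un_le[of Z Y] Y by auto
  qed (use insert.prems Y in auto)
  then obtain h where h: "\<And>e'. e' \<in> I \<Longrightarrow> h e' \<in> [X e' - (Z \<union> Y)]\<^bsup>t\<^esup>" "disjoint_family_on h I" by blast
  have "\<forall>e'\<in>insert e I. (h(e := Y)) e' \<in> [X e' - Z]\<^bsup>t\<^esup>"
    using h(1) Y by (auto simp: nsets_def)
  moreover have "h e' \<inter> Y = {}" if "e' \<in> I" for e' using h(1)[OF that] by (auto simp: nsets_def)
  then have "disjoint_family_on (h(e := Y)) (insert e I)"
    using h(2) insert.hyps unfolding disjoint_family_on_def by (simp add: Int_commute)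
  ultimately show ?case by blast
qed (auto simp: disjoint_family_on_def)

text \<open>The pair \<open>e0\<close> may lie in only \<open>t\<close> hyperedges, so it chooses
  first; every other pair has enough hyperedges to avoid all other choices.\<close>

lemma contains_berge_complete:
  fixes H :: "nat hypergraph"
  assumes H: "uniform_hypergraph r H" and K: "K \<subseteq> verts H" "card K = k"
    and e0: "e0 \<in> [K]\<^bsup>2\<^esup>" "t \<le> card (codeg_edges H e0)"
    and heavy: "\<And>e. e \<in> [K]\<^bsup>2\<^esup> \<Longrightarrow> e \<noteq> e0 \<Longrightarrow> t * (k choose 2) \<le> card (codeg_edges H e)"
  shows "\<exists>G\<in>berge_family t r (complete_graph k). contains_copy H G"
proof -
  have fV: "finite (verts H)" and sub: "hedges H \<subseteq> Pow (verts H)" and r: "\<And>A. A \<in> hedges H \<Longrightarrow> card A = r"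
    using H by (auto simp: uniform_hypergraph_def hypergraph_def)
  have fH: "finite (hedges H)" using fV sub by (metis finite_Pow_iff finite_subset)
  have fK: "finite K" using K fV finite_subset by blast
  have fX: "finite (codeg_edges H e)" for e using fH by (simp add: codeg_edges_def)
  let ?P = "[K]\<^bsup>2\<^esup>"
  have fP: "finite ?P" using fK by (rule finite_imp_finite_nsets)
  have cP: "card ?P = k choose 2" using card_nsets_choose[OF fK] K by simp
  obtain h0 where h0: "h0 \<subseteq> codeg_edges H e0" "card h0 = t" "finite h0"
    using obtain_subset_with_card_n[OF e0(2)] by blast
  have "card (?P - {e0}) + 1 = k choose 2" using card_Suc_Diff1[OF fP e0(1)] cP by simp
  then have "card h0 + t * card (?P - {e0}) = t * (k choose 2)" using h0(2)
    by (metis add.commute add_mult_distrib2 mult.right_neutral)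
  then have "\<exists>h. (\<forall>e\<in>?P - {e0}. h e \<in> [codeg_edges H e - h0]\<^bsup>t\<^esup>) \<and> disjoint_family_on h (?P - {e0})"
    using fP h0 fX heavy by (intro disjoint_subsets_avoiding) auto
  then obtain h1 where h1: "\<And>e. e \<in> ?P - {e0} \<Longrightarrow> h1 e \<in> [codeg_edges H e - h0]\<^bsup>t\<^esup>"
    "disjoint_family_on h1 (?P - {e0})" by blast
  define h where "h = h1(e0 := h0)"
  have h: "h e \<subseteq> codeg_edges H e \<and> finite (h e) \<and> card (h e) = t" if "e \<in> ?P" for e
    using h1(1)[of e] h0 that by (cases "e = e0") (auto simp: h_def nsets_def)
  have hd: "disjoint_family_on h ?P"
    unfolding disjoint_family_on_def
  proof (intro ballI impI)
    fix e e' assume *: "e \<in> ?P" "e' \<in> ?P" "e \<noteq> e'"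
    show "h e \<inter> h e' = {}"
      using h1(1)[of e] h1(1)[of e'] disjoint_family_onD[OF h1(2), of e e'] *
      by (cases "e = e0"; cases "e' = e0") (auto simp: h_def nsets_def)
  qed
  \<comment> \<open>A Berge copy has exactly \<open>t * (k choose 2)\<close> hyperedges, so only the
    chosen ones are kept; additional vertices are allowed.\<close>
  define G where "G = (verts H, \<Union>e\<in>?P. h e)"
  have hG: "hedges G \<subseteq> hedges H" using h by (auto simp: G_def codeg_edges_def)
  have uG: "uniform_hypergraph r G"
    using fV sub r hG by (auto simp: uniform_hypergraph_def hypergraph_def G_def)
  have cG: "card (hedges G) = t * card ?P"
    unfolding G_def using h hd fP by (simp add: card_UN_disjoint disjoint_family_on_def)
  obtain i where i: "bij_betw i {..<k} K"
    using fK K by (metis card_lessThan finite_lessThan finite_same_card_bij)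
  have inj: "inj_on i {..<k}" and im: "i ` {..<k} = K" using i by (auto simp: bij_betw_def)
  have iP: "i ` e \<in> ?P" if e: "e \<in> [{..<k}]\<^bsup>2\<^esup>" for e
  proof -
    have "inj_on i e" "e \<subseteq> {..<k}" using inj e by (auto simp: nsets_def intro: inj_on_subset)
    then show ?thesis using e im by (auto simp: nsets_def card_image)
  qed
  have "heavy_witness t (complete_graph k) G i (\<lambda>e. h (i ` e))"
    unfolding heavy_witness_def complete_graph_def fst_conv snd_conv
  proof (intro conjI ballI)
    fix e assume e: "e \<in> [{..<k}]\<^bsup>2\<^esup>"
    show "h (i ` e) \<in> [hedges G]\<^bsup>t\<^esup>" using h[OF iP[OF e]] iP[OF e] by (auto simp: nsets_def G_def)
    show "i ` e \<subseteq> A" if "A \<in> h (i ` e)" for A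
      using h[OF iP[OF e]] that by (auto simp: codeg_edges_def)
  qed (use inj im K in \<open>auto simp: G_def\<close>)
  moreover have "disjoint_family_on (\<lambda>e. h (i ` e)) ([{..<k}]\<^bsup>2\<^esup>)"
    unfolding disjoint_family_on_def
  proof (intro ballI impI)
    fix e e' assume *: "e \<in> [{..<k}]\<^bsup>2\<^esup>" "e' \<in> [{..<k}]\<^bsup>2\<^esup>" "e \<noteq> e'"
    then have "i ` e \<noteq> i ` e'" using inj_on_image_eq_iff[OF inj, of e e'] by (auto simp: nsets_def)
    then show "h (i ` e) \<inter> h (i ` e') = {}" using disjoint_family_onD[OF hd] iP * by blast
  qed
  moreover have "card ([{..<k}]\<^bsup>2\<^esup>) = card ?P" using card_nsets_choose[of "{..<k}"] cP by simp
  ultimately have "berge_copy t (complete_graph k) G"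
    unfolding berge_copy_def using cG by (auto simp: complete_graph_def)
  moreover have "contains_copy H G"
    unfolding contains_copy_def by (rule exI[of _ id]) (use hG in \<open>auto simp: G_def\<close>)
  ultimately have "G \<in> berge_family t r (complete_graph k)" "contains_copy H G"
    using uG by (simp_all add: berge_family_def)
  then show ?thesis by (rule bexI[rotated])
qed

lemma berge_free_card_le:
  fixes k r t :: nat
  assumes k: "k > r" "r > 2" and t: "t \<ge> 1"
  shows "\<exists>N. \<forall>H :: nat hypergraph. uniform_hypergraph r H \<longrightarrow>
    (\<forall>G\<in>berge_family t r (complete_graph k). \<not> contains_copy H G) \<longrightarrow> N \<le> card (verts H) \<longrightarrow>
    card (hedges H) + (t - 1) * tau 2 (card (verts H)) (k - 1) \<le>
      tau r (card (verts H)) (k - 1) + (t - 1) * (card (verts H) choose 2)"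
proof -
  define c where "c = t - 1"
  define D where "D = t * (k choose 2)"
  define p where "p = k - 1"
  have p: "3 \<le> r" "r \<le> p" "Suc p = k" "k = p - 1 + 2" using k by (auto simp: p_def)
  have "k choose 2 \<ge> 1" using k by (simp add: Suc_leI zero_less_binomial)
  then have D: "D \<ge> t" "D \<ge> 1" using t by (auto simp: D_def Suc_leI)
  obtain N where N: "\<And>(E :: nat \<Rightarrow> nat \<Rightarrow> bool) V. sgraph E \<Longrightarrow> finite V \<Longrightarrow> kcliques E (Suc p) V = {} \<Longrightarrow>
      N \<le> card V \<Longrightarrow> score r c D (p - 1) E V + c * tau 2 (card V) p \<le> tau r (card V) p + c * (card V choose 2)"
    using score_bound[OF p(1,2), of c D] by blast
  have "card (hedges H) + c * tau 2 (card (verts H)) p \<le> tau r (card (verts H)) p + c * (card (verts H) choose 2)"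
    if H: "uniform_hypergraph r H" and bfree: "\<forall>G\<in>berge_family t r (complete_graph k). \<not> contains_copy H G"
      and n: "N \<le> card (verts H)" for H :: "nat hypergraph"
  proof -
    define V where "V = verts H"
    have V: "finite V" and sub: "hedges H \<subseteq> Pow V" and r: "\<And>A. A \<in> hedges H \<Longrightarrow> card A = r"
      using H by (auto simp: uniform_hypergraph_def hypergraph_def V_def)
    have fH: "finite (hedges H)" using V sub by (metis finite_Pow_iff finite_subset)
    define E where "E x y \<longleftrightarrow> x \<noteq> y \<and> D \<le> card (codeg_edges H {x, y})" for x y
    have E: "sgraph E" by (rule sgraphI) (auto simp: E_def insert_commute)
    have light: "card (codeg_edges H e0) < t"
      if K: "K \<subseteq> V" "card K = k" "e0 \<in> [K]\<^bsup>2\<^esup>"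
        and KE: "\<And>x y. x \<in> K \<Longrightarrow> y \<in> K \<Longrightarrow> x \<noteq> y \<Longrightarrow> {x, y} \<noteq> e0 \<Longrightarrow> E x y" for K e0
    proof (rule ccontr)
      assume "\<not> card (codeg_edges H e0) < t"
      moreover have "t * (k choose 2) \<le> card (codeg_edges H e)" if e: "e \<in> [K]\<^bsup>2\<^esup>" "e \<noteq> e0" for e
      proof -
        obtain x y where "e = {x, y}" "x \<in> K" "y \<in> K" "x \<noteq> y" by (rule nsets2_E[OF e(1)])
        then show ?thesis using KE[of x y] e by (auto simp: E_def D_def)
      qed
      ultimately show False
        using contains_berge_complete[OF H, of K k e0 t] K bfree by (auto simp: V_def)
    qed
    have free: "kcliques E (Suc p) V = {}"
    proof (rule equals0I)
      fix K assume K: "K \<in> kcliques E (Suc p) V"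
      then have cK: "K \<subseteq> V" "finite K" "card K = k" and KE: "\<And>x y. x \<in> K \<Longrightarrow> y \<in> K \<Longrightarrow> x \<noteq> y \<Longrightarrow> E x y"
        using p(3) by (auto simp: kcliques_def cliques_def)
      have "2 \<le> card K" using cK k by simp
      then obtain e0 where e0: "e0 \<subseteq> K" "card e0 = 2" "finite e0" by (rule obtain_subset_with_card_n)
      then have e0K: "e0 \<in> [K]\<^bsup>2\<^esup>" by (simp add: nsets_def)
      then obtain x y where xy: "e0 = {x, y}" "x \<in> K" "y \<in> K" "x \<noteq> y" by (auto elim: nsets2_E)
      have "card (codeg_edges H e0) < t" using light[OF cK(1,3) e0K] KE by blast
      moreover have "D \<le> card (codeg_edges H e0)" using KE[OF xy(2-4)] xy by (simp add: E_def)
      ultimately show False using D by simp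
    qed
    \<comment> \<open>A nonedge that is not addable completes to a \<open>k\<close>-set whose other
      pairs are all heavy, so \<open>light\<close> gives at most \<open>t - 1 = c\<close>
      hyperedges. For an addable pair only the bound by \<open>D\<close> is available.\<close>
    have cX: "card (codeg_edges H e) \<le> c + D * of_bool (e \<in> addable (p - 1) E V)" if e: "e \<in> nonedges E V" for e
    proof -
      obtain x y where xy: "e = {x, y}" "x \<in> V" "y \<in> V" "x \<noteq> y"
        using e unfolding nonedges_def by (auto elim: nsets2_E)
      have "\<not> E x y" using e xy sgraph_sym[OF E] by (auto simp: nonedges_def cliques_def)
      then have 1: "card (codeg_edges H e) < D" using xy by (simp add: E_def)
      show ?thesis
      proof (cases "e \<in> addable (p - 1) E V")
        case False
        then obtain S where S: "S \<in> kcliques E (p - 1) (common_nbrs E V e)" using e by (auto simp: addable_def)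
        then have S': "S \<subseteq> V" "finite S" "card S = p - 1" "\<And>a b. a \<in> S \<Longrightarrow> b \<in> S \<Longrightarrow> a \<noteq> b \<Longrightarrow> E a b"
          "\<And>a b. a \<in> e \<Longrightarrow> b \<in> S \<Longrightarrow> E a b \<and> E b a"
          using sgraph_sym[OF E] by (auto simp: kcliques_def cliques_def common_nbrs_def)
        have disj: "e \<inter> S = {}" using S'(5) sgraph_irrefl[OF E] by blast
        have "card (codeg_edges H e) < t"
        proof (rule light)
          show "e \<union> S \<subseteq> V" using xy S' by auto
          show "card (e \<union> S) = k" using card_Un_disjoint[of e S] disj S'(2,3) xy p(4) by simp
          show "e \<in> [e \<union> S]\<^bsup>2\<^esup>" using xy by (simp add: nsets_def)
          show "E a b" if "a \<in> e \<union> S" "b \<in> e \<union> S" "a \<noteq> b" "{a, b} \<noteq> e" for a b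
          proof -
            have "\<not> (a \<in> e \<and> b \<in> e)" using that xy by auto
            then show ?thesis using that S' by blast
          qed
        qed
        then show ?thesis by (simp add: c_def)
      qed (use 1 in simp)
    qed
    \<comment> \<open>A hyperedge is either a clique of heavy pairs or is charged to a nonedge that
      it contains.\<close>
    have "hedges H \<subseteq> kcliques E r V \<union> (\<Union>e\<in>nonedges E V. codeg_edges H e)"
    proof
      fix A assume A: "A \<in> hedges H"
      then have AV: "A \<subseteq> V" "finite A" "card A = r" using sub V r finite_subset by blast+
      show "A \<in> kcliques E r V \<union> (\<Union>e\<in>nonedges E V. codeg_edges H e)"
      proof (cases "A \<in> cliques E V")
        case False
        then obtain x y where xy: "x \<in> A" "y \<in> A" "x \<noteq> y" "\<not> E x y" using AV by (auto simp: cliques_def)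
        then have "{x, y} \<in> nonedges E V" using AV by (auto simp: nonedges_def cliques_def)
        moreover have "A \<in> codeg_edges H {x, y}" using A xy by (simp add: codeg_edges_def)
        ultimately show ?thesis by blast
      qed (use AV in \<open>simp add: kcliques_def\<close>)
    qed
    then have "card (hedges H) \<le> card (kcliques E r V \<union> (\<Union>e\<in>nonedges E V. codeg_edges H e))"
      using V fH by (intro card_mono) (auto simp: finite_kcliques finite_nonedges codeg_edges_def)
    also have "\<dots> \<le> card (kcliques E r V) + (\<Sum>e\<in>nonedges E V. card (codeg_edges H e))"
      by (rule order_trans[OF card_Un_le]) (simp add: card_UN_le finite_nonedges V)
    also have "(\<Sum>e\<in>nonedges E V. card (codeg_edges H e)) \<le>
        (\<Sum>e\<in>nonedges E V. c + D * of_bool (e \<in> addable (p - 1) E V))"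
      by (rule sum_mono) (rule cX)
    also have "\<dots> = c * card (nonedges E V) + D * (\<Sum>e\<in>nonedges E V. of_bool (e \<in> addable (p - 1) E V))"
      by (simp add: sum.distrib sum_distrib_left)
    also have "(\<Sum>e\<in>nonedges E V. of_bool (e \<in> addable (p - 1) E V)) = card (addable (p - 1) E V)"
    proof -
      have "nonedges E V \<inter> addable (p - 1) E V = addable (p - 1) E V" by (auto simp: addable_def)
      then show ?thesis using finite_nonedges[OF V, of E] by (simp add: of_bool_def sum.If_cases)
    qed
    finally have "card (hedges H) \<le> score r c D (p - 1) E V" by (simp add: score_def)
    then show ?thesis using N[OF E V free] n by (simp add: V_def)
  qed
  then show ?thesis unfolding c_def p_def by blast
qed

section \<open>The extremal construction\<close>

text \<open>Each new vertex joins a smallest class.\<close>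

lemma exists_balanced:
  fixes n p :: nat
  assumes "p \<ge> 1"
  shows "\<exists>col. balanced col {..<n} {..<p}"
proof (induction n)
  case (Suc n)
  then obtain col where col: "balanced col {..<n} {..<p}" by blast
  define f where "f i = card {x \<in> {..<n}. col x = i}" for i
  have bal: "f i \<le> f j + 1" if "i < p" "j < p" for i j
    using col that by (simp add: balanced_def f_def)
  have "Min (f ` {..<p}) \<in> f ` {..<p}" using assms by (intro Min_in) (auto simp: lessThan_empty_iff)
  then obtain i where i: "i < p" "f i = Min (f ` {..<p})" by auto
  have min: "f i \<le> f j" if "j < p" for j using i that by simp
  have "card {x \<in> {..<Suc n}. (col(n := i)) x = j} = (if j = i then f i + 1 else f j)" for j
  proof -
    have "{x \<in> {..<Suc n}. (col(n := i)) x = j} =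
        (if j = i then insert n {x \<in> {..<n}. col x = i} else {x \<in> {..<n}. col x = j})"
      by (auto simp: less_Suc_eq)
    then show ?thesis by (simp add: f_def)
  qed
  moreover have "col(n := i) ` {..<Suc n} \<subseteq> {..<p}"
    using col i(1) by (auto simp: balanced_def less_Suc_eq image_subset_iff)
  moreover have "f j \<le> f i + 1" if "j < p" for j using bal[OF that i(1)] .
  ultimately have "balanced (col(n := i)) {..<Suc n} {..<p}"
    using min bal unfolding balanced_def by (auto intro: le_SucI)
  then show ?case by blast
qed (auto simp: balanced_def)

lemma transversals_eq_kcliques:
  assumes P: "\<And>j. j \<in> I \<Longrightarrow> P j = {x \<in> V. col x = j}" and V: "finite V"
  shows "transversals P I s = kcliques (\<lambda>x y. col x \<noteq> col y) s {x \<in> V. col x \<in> I}"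
proof -
  have U: "(\<Union>j\<in>I. P j) = {x \<in> V. col x \<in> I}" using P by auto
  have "(\<forall>j\<in>I. card (A \<inter> P j) \<le> 1) \<longleftrightarrow> (\<forall>x\<in>A. \<forall>y\<in>A. x \<noteq> y \<longrightarrow> col x \<noteq> col y)"
    if A: "A \<subseteq> {x \<in> V. col x \<in> I}" "finite A" for A
  proof
    assume *: "\<forall>j\<in>I. card (A \<inter> P j) \<le> 1"
    show "\<forall>x\<in>A. \<forall>y\<in>A. x \<noteq> y \<longrightarrow> col x \<noteq> col y"
    proof (intro ballI impI notI)
      fix x y assume xy: "x \<in> A" "y \<in> A" "x \<noteq> y" "col x = col y"
      then have "{x, y} \<subseteq> A \<inter> P (col x)" using A P by auto
      then have "card {x, y} \<le> card (A \<inter> P (col x))" using A by (intro card_mono) auto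
      moreover have "card (A \<inter> P (col x)) \<le> 1" using * xy A by auto
      ultimately show False using xy by simp
    qed
  next
    assume *: "\<forall>x\<in>A. \<forall>y\<in>A. x \<noteq> y \<longrightarrow> col x \<noteq> col y"
    show "\<forall>j\<in>I. card (A \<inter> P j) \<le> 1"
    proof
      fix j assume "j \<in> I"
      then have "\<forall>x\<in>A \<inter> P j. \<forall>y\<in>A \<inter> P j. x = y" using P * by auto
      then show "card (A \<inter> P j) \<le> 1" using A card_le_Suc0_iff_eq[of "A \<inter> P j"] by simp
    qed
  qed
  then show ?thesis unfolding transversals_def U kcliques_def cliques_def nsets_def by blast
qed

text \<open>Passes from parts to a colouring, where pairs inside a part become nonedges of the
  multipartite graph and the results on \<open>kcliques\<close> apply.\<close>

lemma Q_hypergraphs_unfold: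
  assumes "Q \<in> Q_hypergraphs t r n p"
  obtains V col S where "card V = n" "balanced col V {..<p}" "verts Q = V"
    "hedges Q = kcliques (\<lambda>x y. col x \<noteq> col y) r V \<union>
      (\<Union>e\<in>nonedges (\<lambda>x y. col x \<noteq> col y) V. (\<lambda>X. e \<union> X) ` S e)"
    "\<And>e. e \<in> nonedges (\<lambda>x y. col x \<noteq> col y) V \<Longrightarrow>
      S e \<in> [kcliques (\<lambda>x y. col x \<noteq> col y) (r - 2) {x \<in> V. col x \<notin> col ` e}]\<^bsup>(t - 1)\<^esup>"
proof -
  from assms obtain V P S where Q: "Q = (V, hedges (turan_hypergraph r p P) \<union>
      (\<Union>i<p. \<Union>e\<in>[P i]\<^bsup>2\<^esup>. (\<lambda>X. e \<union> X) ` S e))"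
    and n: "card V = n" and bal: "balanced_parts V p P"
    and S: "\<And>i e. i < p \<Longrightarrow> e \<in> [P i]\<^bsup>2\<^esup> \<Longrightarrow> S e \<in> [transversals P ({..<p} - {i}) (r - 2)]\<^bsup>(t - 1)\<^esup>"
    unfolding Q_hypergraphs_def by blast
  have V: "finite V" and U: "(\<Union>j<p. P j) = V" and disj: "disjoint_family_on P {..<p}"
    and sz: "\<And>i j. i < p \<Longrightarrow> j < p \<Longrightarrow> card (P i) \<le> card (P j) + 1"
    using bal by (auto simp: balanced_parts_def)
  have "\<forall>x\<in>V. \<exists>j<p. x \<in> P j" using U by auto
  then obtain col where col: "\<And>x. x \<in> V \<Longrightarrow> col x < p \<and> x \<in> P (col x)" by metis
  have P: "P j = {x \<in> V. col x = j}" if "j < p" for j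
  proof -
    have "col x = j" if "x \<in> P j" for x
    proof -
      have "x \<in> V" using that U \<open>j < p\<close> by auto
      then show ?thesis using col[of x] disjoint_family_onD[OF disj, of "col x" j] that \<open>j < p\<close> by auto
    qed
    then show ?thesis using col U that by auto
  qed
  let ?F = "\<lambda>x y. col x \<noteq> col y"
  have balc: "balanced col V {..<p}"
    unfolding balanced_def using V col sz P by auto
  have VI: "{x \<in> V. col x \<in> {..<p}} = V" using col by auto
  have T: "transversals P {..<p} r = kcliques ?F r V"
    using transversals_eq_kcliques[of "{..<p}" P V col r] P V VI by simp
  have ne: "e \<in> nonedges ?F V \<longleftrightarrow> (\<exists>i<p. e \<in> [P i]\<^bsup>2\<^esup>)" for e
  proof
    assume e: "e \<in> nonedges ?F V"
    then obtain x y where xy: "e = {x, y}" "x \<in> V" "y \<in> V" "x \<noteq> y"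
      unfolding nonedges_def by (auto elim: nsets2_E)
    then have "col x = col y" using e by (auto simp: nonedges_def cliques_def)
    then have "e \<in> [P (col x)]\<^bsup>2\<^esup>" using xy col P by auto
    then show "\<exists>i<p. e \<in> [P i]\<^bsup>2\<^esup>" using col xy by blast
  next
    assume "\<exists>i<p. e \<in> [P i]\<^bsup>2\<^esup>"
    then obtain i where i: "i < p" "e \<in> [P i]\<^bsup>2\<^esup>" by blast
    then obtain x y where "e = {x, y}" "x \<in> P i" "y \<in> P i" "x \<noteq> y" by (auto elim: nsets2_E)
    then show "e \<in> nonedges ?F V" using P[OF i(1)] by (auto simp: nonedges_def cliques_def)
  qed
  have "S e \<in> [kcliques ?F (r - 2) {x \<in> V. col x \<notin> col ` e}]\<^bsup>(t - 1)\<^esup>" if eN: "e \<in> nonedges ?F V" for e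
  proof -
    obtain i where i: "i < p" "e \<in> [P i]\<^bsup>2\<^esup>" using iffD1[OF ne eN] by (elim exE conjE)
    then have "col ` e = {i}" using P[OF i(1)] by (auto elim!: nsets2_E)
    then have "{x \<in> V. col x \<in> {..<p} - {i}} = {x \<in> V. col x \<notin> col ` e}" using col by auto
    then show ?thesis
      using S[OF i] transversals_eq_kcliques[of "{..<p} - {i}" P V col "r - 2"] P V by simp
  qed
  moreover have "(\<Union>i<p. \<Union>e\<in>[P i]\<^bsup>2\<^esup>. (\<lambda>X. e \<union> X) ` S e) = (\<Union>e\<in>nonedges ?F V. (\<lambda>X. e \<union> X) ` S e)"
  proof -
    have "nonedges ?F V = (\<Union>i<p. [P i]\<^bsup>2\<^esup>)" using ne by auto
    then show ?thesis by simp
  qed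
  ultimately show ?thesis
    using that[OF n balc, of S] Q T by (simp add: turan_hypergraph_def)
qed

text \<open>An added hyperedge contains exactly one pair inside a part. So different pairs add
  different hyperedges, which gives the count, and such a pair lies in only \<open>t - 1\<close>
  hyperedges. In a heavy copy, two of the \<open>p + 1\<close> core vertices share a part and would
  need \<open>t\<close>.\<close>

lemma Q_hypergraphs_properties:
  assumes Q: "Q \<in> Q_hypergraphs t r n p" and r: "r > 2" and t: "t \<ge> 1"
  shows "uniform_hypergraph r Q" "card (verts Q) = n"
    "card (hedges Q) + (t - 1) * tau 2 n p = tau r n p + (t - 1) * (n choose 2)"
    "G \<in> heavy_family t r (complete_graph (Suc p)) \<Longrightarrow> \<not> contains_copy Q G"
proof -
  obtain V col S where n: "card V = n" and bal: "balanced col V {..<p}" and VQ: "verts Q = V"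
    and HQ: "hedges Q = kcliques (\<lambda>x y. col x \<noteq> col y) r V \<union>
      (\<Union>e\<in>nonedges (\<lambda>x y. col x \<noteq> col y) V. (\<lambda>X. e \<union> X) ` S e)"
    and S: "\<And>e. e \<in> nonedges (\<lambda>x y. col x \<noteq> col y) V \<Longrightarrow>
      S e \<in> [kcliques (\<lambda>x y. col x \<noteq> col y) (r - 2) {x \<in> V. col x \<notin> col ` e}]\<^bsup>(t - 1)\<^esup>"
    using Q_hypergraphs_unfold[OF Q] by blast
  let ?F = "\<lambda>x y. col x \<noteq> col y"
  have V: "finite V" and colV: "col ` V \<subseteq> {..<p}" using bal by (auto simp: balanced_def)
  show "card (verts Q) = n" using n VQ by simp
  have mono: "\<exists>x y. e = {x, y} \<and> x \<in> V \<and> y \<in> V \<and> x \<noteq> y \<and> col x = col y" if e: "e \<in> nonedges ?F V" for e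
  proof -
    obtain x y where xy: "e = {x, y}" "x \<in> V" "y \<in> V" "x \<noteq> y"
      using e unfolding nonedges_def by (auto elim: nsets2_E)
    then have "col x = col y" using e by (auto simp: nonedges_def cliques_def)
    then show ?thesis using xy by blast
  qed
  have fS: "finite (S e)" "card (S e) = t - 1" if "e \<in> nonedges ?F V" for e
    using S[OF that] by (auto simp: nsets_def)
  have SX: "X \<subseteq> V" "finite X" "card X = r - 2" "e \<inter> X = {}"
    "\<And>a b. a \<in> X \<Longrightarrow> b \<in> X \<Longrightarrow> a \<noteq> b \<Longrightarrow> col a \<noteq> col b" "\<And>a b. a \<in> e \<Longrightarrow> b \<in> X \<Longrightarrow> col a \<noteq> col b"
    if e: "e \<in> nonedges ?F V" and X: "X \<in> S e" for e X
  proof -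
    have X': "X \<in> kcliques ?F (r - 2) {x \<in> V. col x \<notin> col ` e}"
      using S[OF e] X by (auto simp: nsets_def)
    then show "X \<subseteq> V" "finite X" "card X = r - 2" by (auto simp: kcliques_def cliques_def)
    have "col b \<notin> col ` e" if "b \<in> X" for b using X' that by (auto simp: kcliques_def cliques_def)
    then show ne: "col a \<noteq> col b" if "a \<in> e" "b \<in> X" for a b using that by (metis imageI)
    then show "e \<inter> X = {}" by (metis disjoint_iff)
    show "\<And>a b. a \<in> X \<Longrightarrow> b \<in> X \<Longrightarrow> a \<noteq> b \<Longrightarrow> col a \<noteq> col b"
      using X' by (simp add: kcliques_def cliques_def)
  qed
  have sep: "e' = e" if e: "e \<in> nonedges ?F V" "e' \<in> nonedges ?F V" and X: "X \<in> S e" and sub: "e' \<subseteq> e \<union> X"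
    for e e' X
  proof -
    obtain x y where xy: "e = {x, y}" "x \<noteq> y" "col x = col y" using mono[OF e(1)] by blast
    obtain x' y' where xy': "e' = {x', y'}" "x' \<noteq> y'" "col x' = col y'" using mono[OF e(2)] by blast
    have "x' \<in> e \<union> X" "y' \<in> e \<union> X" using sub xy' by auto
    moreover from this have "x' \<notin> X \<and> y' \<notin> X"
      using SX(5,6)[OF e(1) X, of x' y'] SX(5,6)[OF e(1) X, of y' x'] xy'(2,3) by auto
    ultimately have "e' \<subseteq> e" using xy'(1) by blast
    then show ?thesis using xy(1) xy'(1,2) by blast
  qed
  have notin: "e \<union> X \<notin> kcliques ?F r V" if e: "e \<in> nonedges ?F V" for e X
    using mono[OF e] by (auto simp: kcliques_def cliques_def)
  have cA: "card (e \<union> X) = r" "e \<union> X \<subseteq> V" if e: "e \<in> nonedges ?F V" and X: "X \<in> S e" for e X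
  proof -
    obtain x y where xy: "e = {x, y}" "x \<in> V" "y \<in> V" "x \<noteq> y" using mono[OF e] by blast
    then show "card (e \<union> X) = r" using card_Un_disjoint[of e X] SX[OF e X] r by simp
    show "e \<union> X \<subseteq> V" using xy SX[OF e X] by auto
  qed
  show "uniform_hypergraph r Q"
    unfolding uniform_hypergraph_def hypergraph_def VQ HQ
    using V cA by (fastforce simp: kcliques_def cliques_def)
  have inj: "inj_on (\<lambda>X. e \<union> X) (S e)" if e: "e \<in> nonedges ?F V" for e
    by (rule inj_onI) (use SX(4)[OF e] in blast)
  have "card (hedges Q) = card (kcliques ?F r V) + card (\<Union>e\<in>nonedges ?F V. (\<lambda>X. e \<union> X) ` S e)"
    unfolding HQ by (rule card_Un_disjoint) (use V notin fS in \<open>auto simp: finite_kcliques finite_nonedges\<close>)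
  also have "card (\<Union>e\<in>nonedges ?F V. (\<lambda>X. e \<union> X) ` S e) = (\<Sum>e\<in>nonedges ?F V. card ((\<lambda>X. e \<union> X) ` S e))"
    by (rule card_UN_disjoint) (use V fS sep in \<open>auto simp: finite_nonedges, blast+\<close>)
  also have "\<dots> = (\<Sum>e\<in>nonedges ?F V. t - 1)"
    by (rule sum.cong) (auto simp: card_image inj fS)
  also have "\<dots> = (t - 1) * card (nonedges ?F V)" by simp
  finally have c: "card (hedges Q) = tau r n p + (t - 1) * card (nonedges ?F V)"
    using card_kcliques_balanced[OF bal] n by simp
  have "card (nonedges ?F V) + tau 2 n p = n choose 2"
    using card_nonedges[OF V, of ?F] card_kcliques_balanced[OF bal, of 2] n by simp
  then show "card (hedges Q) + (t - 1) * tau 2 n p = tau r n p + (t - 1) * (n choose 2)"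
    unfolding c by (metis add.assoc add_mult_distrib2)
  show "\<not> contains_copy Q G" if G: "G \<in> heavy_family t r (complete_graph (Suc p))"
  proof
    assume "contains_copy Q G"
    then obtain f where f: "inj_on f (verts G)" "f ` verts G \<subseteq> V" "\<And>A. A \<in> hedges G \<Longrightarrow> f ` A \<in> hedges Q"
      unfolding contains_copy_def VQ by blast
    have GV: "hedges G \<subseteq> Pow (verts G)"
      using G by (auto simp: heavy_family_def uniform_hypergraph_def hypergraph_def)
    obtain i h where ih: "heavy_witness t (complete_graph (Suc p)) G i h"
      using G by (auto simp: heavy_family_def heavy_copy_def)
    then have i: "inj_on i {..<Suc p}" "i ` {..<Suc p} \<subseteq> verts G"
      and h: "\<And>e. e \<in> [{..<Suc p}]\<^bsup>2\<^esup> \<Longrightarrow> h e \<in> [hedges G]\<^bsup>t\<^esup> \<and> (\<forall>A\<in>h e. i ` e \<subseteq> A)"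
      by (auto simp: heavy_witness_def complete_graph_def)
    have "\<not> inj_on (\<lambda>u. col (f (i u))) {..<Suc p}"
    proof
      assume "inj_on (\<lambda>u. col (f (i u))) {..<Suc p}"
      moreover have "(\<lambda>u. col (f (i u))) ` {..<Suc p} \<subseteq> {..<p}" using i(2) f(2) colV by blast
      ultimately have "card {..<Suc p} \<le> card {..<p}" by (intro card_inj_on_le) auto
      then show False by simp
    qed
    then obtain u v where uv: "u \<in> {..<Suc p}" "v \<in> {..<Suc p}" "u \<noteq> v" "col (f (i u)) = col (f (i v))"
      by (auto simp: inj_on_def)
    have iuv: "i u \<in> verts G" "i v \<in> verts G" "i u \<noteq> i v" using i uv by (auto dest: inj_onD)
    let ?e = "{f (i u), f (i v)}"
    have "f (i u) \<noteq> f (i v)" using f(1) iuv by (auto dest: inj_onD)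
    then have e: "?e \<in> nonedges ?F V" using f(2) iuv uv by (auto simp: nonedges_def cliques_def)
    have he: "h {u, v} \<in> [hedges G]\<^bsup>t\<^esup>" "\<And>A. A \<in> h {u, v} \<Longrightarrow> i ` {u, v} \<subseteq> A"
      using h[of "{u, v}"] uv by auto
    have "inj_on ((`) f) (h {u, v})"
    proof (rule inj_onI)
      fix A A' assume *: "A \<in> h {u, v}" "A' \<in> h {u, v}" "f ` A = f ` A'"
      then have "A \<subseteq> verts G" "A' \<subseteq> verts G" using he(1) GV by (auto simp: nsets_def)
      then show "A = A'" using inj_on_image_eq_iff[OF f(1)] *(3) by blast
    qed
    then have "card ((`) f ` h {u, v}) = t" using he(1) by (simp add: card_image nsets_def)
    moreover have "(`) f ` h {u, v} \<subseteq> (\<lambda>X. ?e \<union> X) ` S ?e"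
    proof (rule image_subsetI)
      fix A assume A: "A \<in> h {u, v}"
      then have "f ` A \<in> hedges Q" using he(1) f(3) by (auto simp: nsets_def)
      moreover have sub: "?e \<subseteq> f ` A" using he(2)[OF A] by auto
      moreover have "f ` A \<notin> kcliques ?F r V" using notin[OF e, of "f ` A"] unfolding Un_absorb1[OF sub] .
      ultimately obtain e' X where e': "e' \<in> nonedges ?F V" "X \<in> S e'" "f ` A = e' \<union> X"
        unfolding HQ by auto
      have "?e = e'" using sep[OF e'(1) e e'(2)] sub e'(3) by simp
      then show "f ` A \<in> (\<lambda>X. ?e \<union> X) ` S ?e" using e' by blast
    qed
    ultimately have "t \<le> card ((\<lambda>X. ?e \<union> X) ` S ?e)" using fS[OF e] by (metis card_mono finite_imageI)
    also have "\<dots> \<le> t - 1" using card_image_le[OF fS(1)[OF e]] fS(2)[OF e] by metis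
    finally show False using t by simp
  qed
qed

text \<open>Outside any part there are at least \<open>(n - 1) / 2 \<ge> t + r\<close> vertices, so
  \<open>tau_ge\<close> yields at least \<open>t - 1\<close> transversals to choose from.\<close>

lemma Q_hypergraphs_nonempty:
  assumes p: "r \<le> p" "r > 2" and n: "n \<ge> 2 * (t + r) + 1"
  shows "Q_hypergraphs t r n p \<noteq> {}"
proof -
  obtain col where bal: "balanced col {..<n} {..<p}" using exists_balanced[of p n] p by auto
  let ?F = "\<lambda>x y. col x \<noteq> col y"
  define P where "P j = {x \<in> {..<n}. col x = j}" for j
  have sz: "card (P i) \<le> card (P j) + 1" if "i < p" "j < p" for i j
    using bal that by (simp add: balanced_def P_def)
  have colV: "col x < p" if "x < n" for x using bal that by (auto simp: balanced_def)
  have big: "t - 1 \<le> card (transversals P ({..<p} - {i}) (r - 2))" if i: "i < p" for i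
  proof -
    let ?I = "{..<p} - {i}"
    let ?W = "{x \<in> {..<n}. col x \<in> ?I}"
    have T: "transversals P ?I (r - 2) = kcliques ?F (r - 2) ?W"
      by (rule transversals_eq_kcliques) (auto simp: P_def)
    have cls: "{x \<in> ?W. col x = j} = P j" if "j \<in> ?I" for j using that by (auto simp: P_def)
    have "balanced col ?W ?I"
      unfolding balanced_def using sz cls by auto
    then have "card (transversals P ?I (r - 2)) = tau (r - 2) (card ?W) (card ?I)"
      unfolding T by (rule card_kcliques_balanced)
    moreover have "card ?I = p - 1" using i by simp
    ultimately have "card (transversals P ?I (r - 2)) = tau (r - 2) (card ?W) (p - 1)" by simp
    moreover have "card ?W + 1 \<le> tau (r - 2) (card ?W) (p - 1) + (r - 2)"
      using p by (intro tau_ge) auto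
    moreover have "n \<le> 2 * card ?W + 1"
    proof -
      obtain j where j: "j < p" "j \<noteq> i"
        using p i by (metis One_nat_def less_trans numeral_2_eq_2 order_less_le_trans zero_less_Suc n_not_Suc_n lessI)
      have "card (P j) \<le> card ?W" using j by (intro card_mono) (auto simp: P_def)
      moreover have "{..<n} = P i \<union> ?W" using colV by (auto simp: P_def)
      then have "n \<le> card (P i) + card ?W" by (metis card_Un_le card_lessThan)
      ultimately show ?thesis using sz[OF i j(1)] by linarith
    qed
    moreover have "t - 1 \<le> T'" if "w + 1 \<le> T' + (r - 2)" "n \<le> 2 * w + 1" for w T' :: nat
      using that n p(2) by simp
    ultimately show ?thesis by metis
  qed
  \<comment> \<open>The choice has to be a function of the pair alone; its colour recovers the index
    of the part.\<close>
  define S where "S e = (SOME Y. Y \<in> [transversals P ({..<p} - col ` e) (r - 2)]\<^bsup>(t - 1)\<^esup>)" for e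
  have "S e \<in> [transversals P ({..<p} - {i}) (r - 2)]\<^bsup>(t - 1)\<^esup>" if i: "i < p" and e: "e \<in> [P i]\<^bsup>2\<^esup>" for i e
  proof -
    have ce: "col ` e = {i}" using e by (auto simp: P_def elim!: nsets2_E)
    obtain Y where "Y \<subseteq> transversals P ({..<p} - {i}) (r - 2)" "card Y = t - 1" "finite Y"
      using obtain_subset_with_card_n[OF big[OF i]] by blast
    then have "Y \<in> [transversals P ({..<p} - {i}) (r - 2)]\<^bsup>(t - 1)\<^esup>" by (simp add: nsets_def)
    then show ?thesis unfolding S_def ce by (rule someI)
  qed
  moreover have "balanced_parts {..<n} p P"
    unfolding balanced_parts_def disjoint_family_on_def using sz colV by (auto simp: P_def)
  ultimately have "({..<n}, hedges (turan_hypergraph r p P) \<union> (\<Union>i<p. \<Union>e\<in>[P i]\<^bsup>2\<^esup>. (\<lambda>X. e \<union> X) ` S e))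
      \<in> Q_hypergraphs t r n p"
    unfolding Q_hypergraphs_def by (intro CollectI exI[of _ "{..<n}"] exI[of _ P] exI[of _ S]) auto
  then show ?thesis by blast
qed

section \<open>Equality of the extremal numbers\<close>

lemma ex_number_eqI:
  fixes H :: "nat hypergraph"
  assumes "uniform_hypergraph r H" "card (verts H) = n" "\<And>G. G \<in> \<F> \<Longrightarrow> \<not> contains_copy H G"
    and max: "\<And>H' :: nat hypergraph. uniform_hypergraph r H' \<Longrightarrow> card (verts H') = n \<Longrightarrow>
      (\<forall>G\<in>\<F>. \<not> contains_copy H' G) \<Longrightarrow> card (hedges H') \<le> card (hedges H)"
  shows "ex_number r n \<F> = card (hedges H)"
  unfolding ex_number_def
proof (rule Max_eqI)
  \<comment> \<open>There may be infinitely many such hypergraphs on \<open>nat\<close>, but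
    \<open>max\<close> bounds their numbers of hyperedges.\<close>
  show "finite {card (hedges H) | H :: nat hypergraph.
      uniform_hypergraph r H \<and> card (verts H) = n \<and> (\<forall>G\<in>\<F>. \<not> contains_copy H G)}"
    by (rule finite_subset[of _ "{..card (hedges H)}"]) (use max in auto)
  show "card (hedges H) \<in> {card (hedges H) | H :: nat hypergraph.
      uniform_hypergraph r H \<and> card (verts H) = n \<and> (\<forall>G\<in>\<F>. \<not> contains_copy H G)}"
    using assms(1-3) by blast
qed (use max in auto)

lemma berge_family_subset_heavy_family: "berge_family t r F \<subseteq> heavy_family t r F"
  by (auto simp: berge_family_def heavy_family_def berge_copy_def heavy_copy_def)

theorem theorem3:
  fixes k r t :: nat
  assumes "k > r" and "r > 2" and "t \<ge> 1"
  shows "\<forall>\<^sub>F n in sequentially.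
           ex_number r n (berge_family t r (complete_graph k)) =
             ex_number r n (heavy_family t r (complete_graph k)) \<and>
           Q_hypergraphs t r n (k - 1) \<noteq> {} \<and>
           (\<forall>Q \<in> Q_hypergraphs t r n (k - 1).
              ex_number r n (heavy_family t r (complete_graph k)) = card (hedges Q))"
proof -
  obtain N where N: "\<And>H :: nat hypergraph. uniform_hypergraph r H \<Longrightarrow>
    (\<forall>G\<in>berge_family t r (complete_graph k). \<not> contains_copy H G) \<Longrightarrow> N \<le> card (verts H) \<Longrightarrow>
    card (hedges H) + (t - 1) * tau 2 (card (verts H)) (k - 1) \<le>
      tau r (card (verts H)) (k - 1) + (t - 1) * (card (verts H) choose 2)"
    using berge_free_card_le[OF assms] by blast
  have k: "Suc (k - 1) = k" "r \<le> k - 1" using assms by auto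
  have "ex_number r n (berge_family t r (complete_graph k)) = card (hedges Q) \<and>
      ex_number r n (heavy_family t r (complete_graph k)) = card (hedges Q)"
    if n: "n \<ge> N" and Q: "Q \<in> Q_hypergraphs t r n (k - 1)" for n Q
  proof -
    note props = Q_hypergraphs_properties[OF Q assms(2,3), unfolded k]
    \<comment> \<open>Every Berge copy is heavy, so avoiding Berge copies is the weaker condition:
      this upper bound serves both families, and \<open>Q\<close> avoids both.\<close>
    have le: "card (hedges H) \<le> card (hedges Q)"
      if "uniform_hypergraph r H" "card (verts H) = n"
        "\<forall>G\<in>berge_family t r (complete_graph k). \<not> contains_copy H G" for H :: "nat hypergraph"
      using N[OF that(1,3)] that(2) n props(3) by simp
    show ?thesis
    proof
      show "ex_number r n (berge_family t r (complete_graph k)) = card (hedges Q)"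
        by (rule ex_number_eqI[OF props(1,2) _ le])
          (use props(4) berge_family_subset_heavy_family in blast)+
      show "ex_number r n (heavy_family t r (complete_graph k)) = card (hedges Q)"
        by (rule ex_number_eqI[OF props(1,2) props(4) le])
          (use berge_family_subset_heavy_family in blast)+
    qed
  qed
  moreover have "Q_hypergraphs t r n (k - 1) \<noteq> {}" if "n \<ge> 2 * (t + r) + 1" for n
    using Q_hypergraphs_nonempty[OF k(2) assms(2) that] .
  ultimately have "\<forall>n \<ge> N + (2 * (t + r) + 1).
           ex_number r n (berge_family t r (complete_graph k)) =
             ex_number r n (heavy_family t r (complete_graph k)) \<and>
           Q_hypergraphs t r n (k - 1) \<noteq> {} \<and>
           (\<forall>Q \<in> Q_hypergraphs t r n (k - 1).
              ex_number r n (heavy_family t r (complete_graph k)) = card (hedges Q))"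
    by (metis add_leD1 add_leD2 all_not_in_conv)
  then show ?thesis unfolding eventually_sequentially by blast
qed

end
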